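(* Let $(A,(m_p)_{p\in\mathcal P})$ be a $\mathcal P$-tracial algebra and let $(a_n)_{n\ge1}$ be a sequence in $A$ of $\mathcal P$-free elements which all have the same $\mathcal P$-distribution and such that $\mathcal R_1(a_1)=0$. Then $\frac1{\sqrt n}\sum_{i=1}^n a_i$ converges in $\mathcal P$-distribution, as $n\to\infty$, to a centered $\mathcal P$-Gaussian element whose $\mathcal R$-transform is $e^{\boxplus\mathcal R_2(a_1)}$.
   Context: Partitions. For $k\ge 0$, $\mathcal P_k$ is the set of partitions of $\{1,\dots,k,1',\dots,k'\}$ ($\mathcal P_0=\{\emptyset\}$) and $\mathcal P=\bigcup_k\mathcal P_k$. A partition is drawn as a diagram with a top row $1,\dots,k$ and a bottom row $1',\dots,k'$. $\mathrm{nc}(p)$ is the number of blocks of $p$; $p\vee p'$ is the finest partition coarser than both; $\mathrm{id}_k=\{\{i,i'\}:1\le i\le k\}$. The cycles of $p$ are the blocks of $p\vee\mathrm{id}_k$. A permutation $\sigma$ is identified with $\{\{i,\sigma(i)'\}\}$. $p\circ p'$ is obtained by putting $p'$ above $p$, identifying the bottom row of $p'$ with the top row of $p$, then erasing the middle row and keeping connections. $p\otimes p'$ is obtained by putting $p'$ to the right of $p$. Set $d(p,p')=\frac{\mathrm{nc}(p)+\mathrm{nc}(p')}{2}-\mathrm{nc}(p\vee p')$ and $p\le p'$ if $d(\mathrm{id}_k,p)+d(p,p')=d(\mathrm{id}_k,p')$ (a partial order). For $I\subset\{1,\dots,k\}$, the extraction $p_I$ is formed by the non-empty intersections of blocks of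 $p$ with $I\cup I'$, relabelled increasingly. $\mathfrak F_2(p)$ is the set of triples $(p_1,p_2,I)$ with $I\subset\{1,\dots,k\}$, $p_1=p_I$, $p_2=p_{\{1,\dots,k\}\setminus I}$ and $\mathrm{nc}(p_1)+\mathrm{nc}(p_2)=\mathrm{nc}(p)$. $\mathfrak S_k$ acts on $\mathcal P_k$ by $p\mapsto\sigma\circ p\circ\sigma^{-1}$. For linear forms $\phi_1,\phi_2\in\big(\bigoplus_{k\ge0}\mathbb C[\mathcal P_k/\mathfrak S_k]\big)^*$: $(\phi_1\boxplus\phi_2)(p)=\sum_{(p_1,p_2,I)\in\mathfrak F_2(p)}\phi_1(p_1)\phi_2(p_2)$; the unit for $\boxplus$ is the form equal to $1$ on $\emptyset$ and $0$ elsewhere, and $e^{\boxplus\phi}=\sum_{n\ge0}\frac1{n!}\phi^{\boxplus n}$. $\mathcal P$-tracial algebra. For $p\in\mathcal P_k$, $l\ge k$ and $1\le i_1<\dots<i_k\le l$, $\mathrm{Ins}^l_{(i_1,\dots,i_k)}(p)\in\mathcal P_l$ is obtained by relabelling $j\mapsto i_j$, $j'\mapsto i_j'$ in $p$ and adding the blocks $\{i,i'\}$ for $i\notin\{i_1,\dots,i_k\}$. A $\mathcal P$-tracial algebra $(A,(m_p)_{p\in\mathcal P})$ is a (complex) algebra $A$ with $k$-linear forms $m_p:A^k\to\mathbb C$ for $p\in\mathcal P_k$ ($m_\emptyset=1$) such that (1) $m_p(a_1,\dots,a_k)=m_{\sigma\circ p\circ\sigma^{-1}}(a_{\sigma^{-1}(1)},\dots,a_{\sigma^{-1}(k)})$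 for all $\sigma\in\mathfrak S_k$; (2) $m_p\big(\prod_{i=1}^{n_1}a^{(1)}_i,\dots,\prod_{i=1}^{n_k}a_i^{(k)}\big)=m_{\mathrm{Ins}^{n}_{\mathbf i}(p)\circ\sigma}(a^{(1)}_1,\dots,a^{(1)}_{n_1},\dots,a^{(k)}_1,\dots,a^{(k)}_{n_k})$, with $n=\sum_j n_j$, $\mathbf i=(1,1+n_1,\dots,1+n_1+\dots+n_{k-1})$ and $\sigma=(1,\dots,n_1)(n_1+1,\dots,n_1+n_2)\cdots(n_1+\dots+n_{k-1}+1,\dots,n)$. The $\mathcal P$-cumulants $(\kappa_p)$ are the unique multilinear forms with $m_p=\sum_{p'\in\mathcal P_k,\,p'\le p}\kappa_{p'}$ for all $p\in\mathcal P_k$ ($\kappa_\emptyset=1$). The $\mathcal P$-distribution of $a\in A$ is the linear form $p\mapsto m_p(a,\dots,a)$ and its $\mathcal R$-transform $\mathcal R(a)$ is the linear form $p\mapsto\kappa_p(a,\dots,a)$. For $i\ge0$, $\mathcal R_i(a)$ is the form equal to $\mathcal R(a)$ on $\mathcal P_i$ and to $0$ on $\mathcal P_k$, $k\ne i$. An element $a$ is a centered $\mathcal P$-Gaussian if $\mathcal R(a)=e^{\boxplus\mathcal R_2(a)}$. A sequence $(c_n)$ converges in $\mathcal P$-distribution if $m_p(c_n,\dots,c_n)$ converges for every $p\in\mathcal P$; convergence to an element with $\mathcal R$-transform $\phi$ means $m_p(c_n,\dots,c_n)\to\sum_{p'\le p}\phi(p')$ for all $p$ (equivalently $\kappa_p(c_n,\dots,c_n)\to\phi(p)$).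 $\mathcal P$-free sequence. Let $A_n$ be the algebra generated by $a_n$. The $a_n$ are $\mathcal P$-free if (i) for all $k$, $p\in\mathcal P_k$ and $(x_1,\dots,x_k)$ with $x_i\in A_{\epsilon(i)}$, $\epsilon(i)\in\mathbb N$, if some cycle of $p$ contains $i$ and $j$ with $\epsilon(i)\neq\epsilon(j)$ then $\kappa_p(x_1,\dots,x_k)=0$; (ii) if $p=p_1\otimes\dots\otimes p_r$ and $\epsilon$ is constant on the indices of each $p_s$ with pairwise distinct values for distinct $s$, then $\kappa_p(x_1,\dots,x_k)$ is the product over $s$ of the $\kappa_{p_s}$ evaluated at the corresponding entries. *)

theory Defs
  imports Complex_Main "HOL-Library.Disjoint_Sets" "HOL-Combinatorics.Combinatorics"
begin

section \<open>Partitions\<close>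

text \<open>
  Columns are numbered from 0, to agree with list indices: the points \<open>i\<close> and \<open>i'\<close> for
  \<open>1 \<le> i \<le> k\<close> are \<open>(Top, i - 1)\<close> and \<open>(Bot, i - 1)\<close>. The row \<open>Mid\<close> is only used inside \<open>part_compose\<close>.
\<close>

datatype row = Top | Mid | Bot

type_synonym partition = "(row \<times> nat) set set"

definition points :: "nat \<Rightarrow> (row \<times> nat) set" where
  "points k = {Top, Bot} \<times> {..<k}"

definition Parts :: "nat \<Rightarrow> partition set" where
  "Parts k = {p. partition_on (points k) p}"

definition All_Parts :: "partition set" where
  "All_Parts = (\<Union>k. Parts k)"

text \<open>The \<open>k\<close> with \<open>p \<in> Parts k\<close>, see \<open>deg_Parts\<close> below.\<close>

definition deg :: "partition \<Rightarrow> nat" where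
  "deg p = card {i. (Top, i) \<in> \<Union>p}"

definition nc :: "partition \<Rightarrow> nat" where
  "nc p = card p"

definition join :: "partition \<Rightarrow> partition \<Rightarrow> partition" where
  "join p q = (THE r. refines (\<Union>p) p r \<and> refines (\<Union>p) q r \<and>
     (\<forall>s. refines (\<Union>p) p s \<and> refines (\<Union>p) q s \<longrightarrow> refines (\<Union>p) r s))"

text \<open>Permutations are maps \<open>\<sigma>\<close> with \<open>\<sigma> permutes {..<k}\<close>.\<close>

definition perm_part :: "nat \<Rightarrow> (nat \<Rightarrow> nat) \<Rightarrow> partition" where
  "perm_part k \<sigma> = {{(Top, i), (Bot, \<sigma> i)} | i. i < k}"

definition id_part :: "nat \<Rightarrow> partition" where
  "id_part k = perm_part k id"

definition part_cycles :: "nat \<Rightarrow> partition \<Rightarrow> partition" where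
  "part_cycles k p = join p (id_part k)"

text \<open>The connected components of the graph in which any two points in a common member of \<open>B\<close> are
  adjacent.\<close>

definition components :: "'v set set \<Rightarrow> 'v set set" where
  "components B = \<Union>B // {(x, y). \<exists>b\<in>B. x \<in> b \<and> y \<in> b}\<^sup>*"

fun upper_row :: "row \<Rightarrow> row" where
  "upper_row Bot = Mid"
| "upper_row r = r"

fun lower_row :: "row \<Rightarrow> row" where
  "lower_row Top = Mid"
| "lower_row r = r"

text \<open>\<open>part_compose p q\<close> is \<open>p \<circ> q\<close>: the diagram \<open>q\<close> occupies the rows \<open>Top\<close> and \<open>Mid\<close>, and \<open>p\<close> the rows
  \<open>Mid\<close> and \<open>Bot\<close>.\<close>

definition part_compose :: "partition \<Rightarrow> partition \<Rightarrow> partition" where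
  "part_compose p q =
     (\<lambda>c. c \<inter> {Top, Bot} \<times> UNIV) `
       components ((`) (map_prod upper_row id) ` q \<union> (`) (map_prod lower_row id) ` p) - {{}}"

definition conj_part :: "nat \<Rightarrow> (nat \<Rightarrow> nat) \<Rightarrow> partition \<Rightarrow> partition" where
  "conj_part k \<sigma> p = part_compose (part_compose (perm_part k \<sigma>) p) (perm_part k (inv \<sigma>))"

definition tensor :: "partition \<Rightarrow> partition \<Rightarrow> partition" where
  "tensor p q = p \<union> (`) (map_prod id (\<lambda>j. deg p + j)) ` q"

definition tensor_list :: "partition list \<Rightarrow> partition" where
  "tensor_list ps = foldr tensor ps {}"

definition part_dist :: "partition \<Rightarrow> partition \<Rightarrow> real" where
  "part_dist p q = (real (nc p) + real (nc q)) / 2 - real (nc (join p q))"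

definition part_le :: "nat \<Rightarrow> partition \<Rightarrow> partition \<Rightarrow> bool" where
  "part_le k p q \<longleftrightarrow> part_dist (id_part k) p + part_dist p q = part_dist (id_part k) q"

text \<open>The function \<open>\<lambda>i. card {j \<in> I. j < i}\<close> is the increasing relabelling of \<open>I\<close> by
  \<open>{..<card I}\<close>.\<close>

definition extraction :: "partition \<Rightarrow> nat set \<Rightarrow> partition" where
  "extraction p I =
     (\<lambda>b. map_prod id (\<lambda>i. card {j \<in> I. j < i}) ` (b \<inter> UNIV \<times> I)) ` p - {{}}"

definition F2 :: "partition \<Rightarrow> (partition \<times> partition \<times> nat set) set" where
  "F2 p = {(p1, p2, I). I \<subseteq> {..<deg p} \<and> p1 = extraction p I \<and> p2 = extraction p ({..<deg p} - I) \<and>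
     nc p1 + nc p2 = nc p}"

text \<open>\<open>Ins l cs p\<close>, where the list \<open>cs\<close> consists of the (0-based) positions of the columns of \<open>p\<close>.\<close>

definition Ins :: "nat \<Rightarrow> nat list \<Rightarrow> partition \<Rightarrow> partition" where
  "Ins l cs p =
     (`) (map_prod id (\<lambda>j. cs ! j)) ` p \<union> {{(Top, i), (Bot, i)} | i. i < l \<and> i \<notin> set cs}"


section \<open>Linear forms on partitions\<close>

text \<open>
  A linear form on \<open>\<Oplus>\<^sub>k \<complex>[Parts k / \<SS>\<^sub>k]\<close> is represented by its values on \<open>All_Parts\<close>; values
  outside \<open>All_Parts\<close> carry no meaning.
\<close>

type_synonym form = "partition \<Rightarrow> complex"

definition boxplus :: "form \<Rightarrow> form \<Rightarrow> form" where
  "boxplus \<phi>1 \<phi>2 p = (\<Sum>(p1, p2, I)\<in>F2 p. \<phi>1 p1 * \<phi>2 p2)"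

definition box_unit :: form where
  "box_unit p = (if p = {} then 1 else 0)"

definition box_power :: "form \<Rightarrow> nat \<Rightarrow> form" where
  "box_power \<phi> n = (boxplus \<phi> ^^ n) box_unit"

definition box_exp :: "form \<Rightarrow> form" where
  "box_exp \<phi> p = (\<Sum>n. box_power \<phi> n p / fact n)"

definition graded_part :: "nat \<Rightarrow> form \<Rightarrow> form" where
  "graded_part i \<phi> p = (if p \<in> Parts i then \<phi> p else 0)"


section \<open>Tracial algebras over partitions\<close>

text \<open>An associative complex algebra; no unit is required.\<close>

locale complex_algebra = vector_space scale
  for scale :: "complex \<Rightarrow> 'a::ring \<Rightarrow> 'a" +
  assumes scale_mult_left: "scale c x * y = scale c (x * y)"
    and scale_mult_right: "x * scale c y = scale c (x * y)"

definition subalgebra :: "(complex \<Rightarrow> 'a::ring \<Rightarrow> 'a) \<Rightarrow> 'a set \<Rightarrow> bool" where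
  "subalgebra scale S \<longleftrightarrow> module.subspace scale S \<and> (\<forall>x\<in>S. \<forall>y\<in>S. x * y \<in> S)"

definition generated_algebra :: "(complex \<Rightarrow> 'a::ring \<Rightarrow> 'a) \<Rightarrow> 'a \<Rightarrow> 'a set" where
  "generated_algebra scale a = subalgebra scale hull {a}"

text \<open>A family of forms assigns to \<open>p \<in> Parts k\<close> a function of lists of length \<open>k\<close>.\<close>

type_synonym 'a forms = "partition \<Rightarrow> 'a list \<Rightarrow> complex"

definition multilinear :: "(complex \<Rightarrow> 'a::ring \<Rightarrow> 'a) \<Rightarrow> 'a forms \<Rightarrow> bool" where
  "multilinear scale f \<longleftrightarrow>
     (\<forall>k. \<forall>p\<in>Parts k. \<forall>xs i x y c. length xs = k \<and> i < k \<longrightarrow>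
        f p (xs[i := x + y]) = f p (xs[i := x]) + f p (xs[i := y]) \<and>
        f p (xs[i := scale c x]) = c * f p (xs[i := x]))"

text \<open>The product of a non-empty list (the library's \<open>prod_list\<close> needs a unit).\<close>

fun list_product :: "'a::ring list \<Rightarrow> 'a" where
  "list_product [] = 0"
| "list_product [x] = x"
| "list_product (x # y # ys) = x * list_product (y # ys)"

text \<open>For \<open>ns = [n\<^sub>1, \<dots>, n\<^sub>k]\<close> the \<open>j\<close>-th block of consecutive positions is
  \<open>[block_start ns j ..< block_start ns (Suc j)]\<close>.\<close>

definition block_start :: "nat list \<Rightarrow> nat \<Rightarrow> nat" where
  "block_start ns j = sum_list (take j ns)"

definition block_cycle :: "nat list \<Rightarrow> nat \<Rightarrow> nat" where
  "block_cycle ns =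
     foldr (\<circ>) (map (\<lambda>j. cycle_of_list [block_start ns j ..< block_start ns (Suc j)]) [0..<length ns]) id"

definition P_tracial_algebra :: "(complex \<Rightarrow> 'a::ring \<Rightarrow> 'a) \<Rightarrow> 'a forms \<Rightarrow> bool" where
  "P_tracial_algebra scale m \<longleftrightarrow>
     complex_algebra scale \<and>
     multilinear scale m \<and>
     m {} [] = 1 \<and>
     (\<forall>k. \<forall>p\<in>Parts k. \<forall>xs \<sigma>. length xs = k \<and> \<sigma> permutes {..<k} \<longrightarrow>
        m p xs = m (conj_part k \<sigma> p) (permute_list (inv \<sigma>) xs)) \<and>
     (\<forall>k. \<forall>p\<in>Parts k. \<forall>xss. length xss = k \<and> (\<forall>xs\<in>set xss. xs \<noteq> []) \<longrightarrow>
        (let ns = map length xss; n = sum_list ns in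
          m p (map list_product xss) =
          m (part_compose (Ins n (map (block_start ns) [0..<k]) p) (perm_part n (block_cycle ns)))
            (concat xss)))"

text \<open>The last condition of \<open>is_cumulants\<close> fixes irrelevant values, so that \<open>\<kappa>\<close> is unique as a HOL
  function; see \<open>is_cumulants_unique_existence\<close> below.\<close>

definition is_cumulants :: "(complex \<Rightarrow> 'a::ring \<Rightarrow> 'a) \<Rightarrow> 'a forms \<Rightarrow> 'a forms \<Rightarrow> bool" where
  "is_cumulants scale m \<kappa> \<longleftrightarrow>
     multilinear scale \<kappa> \<and>
     \<kappa> {} [] = 1 \<and>
     (\<forall>k. \<forall>p\<in>Parts k. \<forall>xs. length xs = k \<longrightarrow>
        m p xs = (\<Sum>p'\<in>{p' \<in> Parts k. part_le k p' p}. \<kappa> p' xs)) \<and>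
     (\<forall>p xs. p \<notin> Parts (length xs) \<longrightarrow> \<kappa> p xs = 0)"

definition cumulants :: "(complex \<Rightarrow> 'a::ring \<Rightarrow> 'a) \<Rightarrow> 'a forms \<Rightarrow> 'a forms" where
  "cumulants scale m = (THE \<kappa>. is_cumulants scale m \<kappa>)"

definition P_distribution :: "'a forms \<Rightarrow> 'a \<Rightarrow> form" where
  "P_distribution m a p = m p (replicate (deg p) a)"

definition R_transform :: "(complex \<Rightarrow> 'a::ring \<Rightarrow> 'a) \<Rightarrow> 'a forms \<Rightarrow> 'a \<Rightarrow> form" where
  "R_transform scale m a p = cumulants scale m p (replicate (deg p) a)"

text \<open>The elements \<open>a j\<close>, \<open>j \<in> J\<close>, are free. In the second condition \<open>js ! s\<close> is the common value of
  \<open>\<epsilon>\<close> on the columns of the \<open>s\<close>-th tensor factor and \<open>xss ! s\<close> is the list of entries there.\<close>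

definition P_free ::
  "(complex \<Rightarrow> 'a::ring \<Rightarrow> 'a) \<Rightarrow> 'a forms \<Rightarrow> 'i set \<Rightarrow> ('i \<Rightarrow> 'a) \<Rightarrow> bool" where
  "P_free scale m J a \<longleftrightarrow>
     (\<forall>k. \<forall>p\<in>Parts k. \<forall>xs \<epsilon>.
        length xs = k \<and> (\<forall>i<k. \<epsilon> i \<in> J \<and> xs ! i \<in> generated_algebra scale (a (\<epsilon> i))) \<and>
        (\<exists>c\<in>part_cycles k p. \<exists>i j. (Top, i) \<in> c \<and> (Top, j) \<in> c \<and> \<epsilon> i \<noteq> \<epsilon> j) \<longrightarrow>
        cumulants scale m p xs = 0) \<and>
     (\<forall>r ps xss js.
        length ps = r \<and> length xss = r \<and> length js = r \<and> distinct js \<and> set js \<subseteq> J \<and>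
        (\<forall>s<r. ps ! s \<in> Parts (length (xss ! s)) \<and>
               set (xss ! s) \<subseteq> generated_algebra scale (a (js ! s))) \<longrightarrow>
        cumulants scale m (tensor_list ps) (concat xss) =
          (\<Prod>s<r. cumulants scale m (ps ! s) (xss ! s)))"

text \<open>\<open>a\<close> is a centered Gaussian iff \<open>Gaussian_R_transform (R_transform scale m a)\<close>. The limit in
  \<open>P_converges\<close> need not live in the given algebra; it is an element known through its R-transform \<open>\<phi>\<close>.\<close>

definition Gaussian_R_transform :: "form \<Rightarrow> bool" where
  "Gaussian_R_transform \<phi> \<longleftrightarrow> (\<forall>p\<in>All_Parts. \<phi> p = box_exp (graded_part 2 \<phi>) p)"

definition P_converges :: "'a forms \<Rightarrow> (nat \<Rightarrow> 'a) \<Rightarrow> form \<Rightarrow> bool" where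
  "P_converges m c \<phi> \<longleftrightarrow>
     (\<forall>k. \<forall>p\<in>Parts k.
        (\<lambda>n. P_distribution m (c n) p) \<longlonglongrightarrow> (\<Sum>p'\<in>{p' \<in> Parts k. part_le k p' p}. \<phi> p'))"


section \<open>Well-definedness\<close>

lemma deg_Parts:
  assumes "p \<in> Parts k"
  shows "deg p = k"
proof -
  have "\<Union>p = points k"
    using assms by (auto simp: Parts_def partition_on_def)
  then have "{i. (Top, i) \<in> \<Union>p} = {..<k}"
    by (auto simp: points_def)
  then show ?thesis
    by (simp add: deg_def)
qed

lemma finite_Parts: "finite (Parts k)"
  unfolding Parts_def points_def by (intro finitely_many_partition_on) auto

lemma finite_mem_Parts: "p \<in> Parts k \<Longrightarrow> finite p"
  unfolding Parts_def points_def
  by (rule finite_elements[of "{Top, Bot} \<times> {..<k}"]) auto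

lemma id_part_Parts: "id_part k \<in> Parts k"
  unfolding Parts_def id_part_def perm_part_def points_def partition_on_def disjoint_def
  by auto

lemma components_partition:
  assumes "{} \<notin> B"
  shows "partition_on (\<Union>B) (components B)"
proof -
  define R where "R = {(x, y). \<exists>b\<in>B. x \<in> b \<and> y \<in> b}"
  have sym: "sym (R\<^sup>*)"
    by (rule sym_rtrancl) (auto simp: R_def sym_def)
  have closed: "y \<in> \<Union>B" if "(x, y) \<in> R\<^sup>*" "x \<in> \<Union>B" for x y
    using that by (induction rule: rtrancl_induct) (auto simp: R_def)
  have eq: "components B = (\<lambda>x. R\<^sup>* `` {x}) ` \<Union>B"
    by (auto simp: components_def R_def quotient_def)
  have same: "R\<^sup>* `` {x} = R\<^sup>* `` {y}" if "(x, z) \<in> R\<^sup>*" "(y, z) \<in> R\<^sup>*" for x y z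
  proof -
    have "(x, y) \<in> R\<^sup>*" "(y, x) \<in> R\<^sup>*"
      using that sym by (meson rtrancl_trans symD)+
    then show ?thesis by (auto intro: rtrancl_trans)
  qed
  show ?thesis
    unfolding partition_on_def
  proof (intro conjI)
    show "\<Union>(components B) = \<Union>B"
      unfolding eq using closed by blast
    show "disjoint (components B)"
      unfolding eq disjoint_def using same by blast
    show "{} \<notin> components B"
      unfolding eq by blast
  qed
qed

lemma components_coarser:
  assumes "b \<in> B" "b \<noteq> {}"
  shows "\<exists>c\<in>components B. b \<subseteq> c"
proof -
  obtain x where x: "x \<in> b" using assms by blast
  let ?c = "{(x, y). \<exists>b\<in>B. x \<in> b \<and> y \<in> b}\<^sup>* `` {x}"
  have "?c \<in> components B"
    unfolding components_def using x assms by (blast intro: quotientI)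
  moreover have "b \<subseteq> ?c"
    using x assms by (auto intro!: r_into_rtrancl)
  ultimately show ?thesis by blast
qed

lemma components_finest:
  assumes "{} \<notin> B" "partition_on (\<Union>B) s" "\<And>b. b \<in> B \<Longrightarrow> \<exists>c\<in>s. b \<subseteq> c"
  shows "refines (\<Union>B) (components B) s"
  unfolding refines_def
proof (intro conjI ballI components_partition assms(1,2))
  fix X assume "X \<in> components B"
  then obtain x where x: "x \<in> \<Union>B" and X: "X = {(x, y). \<exists>b\<in>B. x \<in> b \<and> y \<in> b}\<^sup>* `` {x}"
    by (auto simp: components_def quotient_def)
  obtain c where c: "c \<in> s" "x \<in> c"
    using x assms(2) by (auto simp: partition_on_def)
  have "y \<in> c" if "(x, y) \<in> {(x, y). \<exists>b\<in>B. x \<in> b \<and> y \<in> b}\<^sup>*" for y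
    using that
  proof (induction rule: rtrancl_induct)
    case base
    show ?case by (rule c)
  next
    case (step y z)
    then obtain b where b: "b \<in> B" "y \<in> b" "z \<in> b" by blast
    then obtain c' where c': "c' \<in> s" "b \<subseteq> c'" using assms(3) by blast
    have "c' = c"
      using assms(2) c c' b step.IH unfolding partition_on_def disjoint_def by blast
    then show ?case using b c' by blast
  qed
  then show "\<exists>Y\<in>s. X \<subseteq> Y" using c X by blast
qed

lemma join_eq_components:
  assumes "p \<in> Parts k" "q \<in> Parts k"
  shows "join p q = components (p \<union> q)"
proof -
  have p: "partition_on (points k) p" and q: "partition_on (points k) q"
    using assms by (auto simp: Parts_def)
  then have V: "\<Union>p = points k" "\<Union>(p \<union> q) = points k" and ne: "{} \<notin> p \<union> q"
    by (auto simp: partition_on_def)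
  have 1: "refines (\<Union>p) p (components (p \<union> q)) \<and> refines (\<Union>p) q (components (p \<union> q))"
    using p q V ne components_partition[OF ne] components_coarser[of _ "p \<union> q"]
    unfolding refines_def by (metis UnCI)
  have 2: "refines (\<Union>p) (components (p \<union> q)) s"
    if "refines (\<Union>p) p s \<and> refines (\<Union>p) q s" for s
    using that components_finest[OF ne, of s] V unfolding refines_def by (metis UnE)
  show ?thesis
    unfolding join_def
  proof (rule the_equality, intro conjI allI impI)
    show "refines (\<Union>p) p (components (p \<union> q))" "refines (\<Union>p) q (components (p \<union> q))"
      using 1 by auto
    show "refines (\<Union>p) (components (p \<union> q)) s"
      if "refines (\<Union>p) p s \<and> refines (\<Union>p) q s" for s
      using 2[OF that] .
    show "r = components (p \<union> q)"
      if "refines (\<Union>p) p r \<and> refines (\<Union>p) q r \<and>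
        (\<forall>s. refines (\<Union>p) p s \<and> refines (\<Union>p) q s \<longrightarrow> refines (\<Union>p) r s)" for r
      using that 1 2 refines_asym by blast
  qed
qed

lemma join_refines:
  assumes "p \<in> Parts k" "q \<in> Parts k"
  shows "refines (points k) p (join p q)" "refines (points k) q (join p q)"
proof -
  have p: "partition_on (points k) p" and q: "partition_on (points k) q"
    using assms by (auto simp: Parts_def)
  then have V: "\<Union>(p \<union> q) = points k" and ne: "{} \<notin> p \<union> q"
    by (auto simp: partition_on_def)
  show "refines (points k) p (join p q)" "refines (points k) q (join p q)"
    using p q V ne components_partition[OF ne] components_coarser[of _ "p \<union> q"]
    unfolding refines_def join_eq_components[OF assms] by (metis UnCI)+
qed

lemma refines_card:
  assumes "refines A p q" "finite p"
  shows "card q \<le> card p" and "card q = card p \<Longrightarrow> p = q"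
proof -
  define f where "f b = (SOME c. c \<in> q \<and> b \<subseteq> c)" for b
  have f: "f b \<in> q" "b \<subseteq> f b" if "b \<in> p" for b
    using assms(1) that someI_ex[of "\<lambda>c. c \<in> q \<and> b \<subseteq> c"]
    unfolding refines_def f_def by blast+
  have P: "\<Union>p = A" "\<Union>q = A" "disjoint q" "{} \<notin> q" "{} \<notin> p"
    using assms(1) unfolding refines_def partition_on_def by auto
  have f_eq: "f b = c" if "b \<in> p" "c \<in> q" "x \<in> b" "x \<in> c" for b c x
    using f[OF that(1)] that P(3) unfolding disjoint_def by blast
  have img: "f ` p = q"
  proof (intro equalityI subsetI)
    fix c assume c: "c \<in> q"
    then obtain x where "x \<in> c" using P(4) by (metis all_not_in_conv)
    moreover obtain b where "b \<in> p" "x \<in> b" using P c \<open>x \<in> c\<close> by blast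
    ultimately show "c \<in> f ` p" using f_eq c by blast
  qed (use f in blast)
  show "card q \<le> card p"
    using img assms(2) card_image_le by blast
  assume "card q = card p"
  then have inj: "inj_on f p"
    using img assms(2) eq_card_imp_inj_on by metis
  have "f b = b" if b: "b \<in> p" for b
  proof (intro equalityI subsetI)
    fix x assume x: "x \<in> f b"
    then obtain b' where b': "b' \<in> p" "x \<in> b'" using P f(1)[OF b] by blast
    then have "f b' = f b" using f_eq[OF b'(1) f(1)[OF b] b'(2) x] by simp
    then show "x \<in> b" using inj b b' by (auto dest: inj_onD)
  qed (use f b in blast)
  then show "p = q" using img by simp
qed

lemma
  assumes "p \<in> Parts k" "q \<in> Parts k"
  shows part_dist_nonneg: "part_dist p q \<ge> 0"
    and part_dist_eq_0: "part_dist p q = 0 \<Longrightarrow> p = q"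
proof -
  note le = refines_card(1)[OF join_refines(1)[OF assms] finite_mem_Parts[OF assms(1)]]
    refines_card(1)[OF join_refines(2)[OF assms] finite_mem_Parts[OF assms(2)]]
  show "part_dist p q \<ge> 0"
    using le by (simp add: part_dist_def nc_def)
  assume "part_dist p q = 0"
  then have "card (join p q) = card p" "card (join p q) = card q"
    using le by (auto simp: part_dist_def nc_def field_simps)
  then show "p = q"
    using refines_card(2)[OF join_refines(1)[OF assms] finite_mem_Parts[OF assms(1)]]
      refines_card(2)[OF join_refines(2)[OF assms] finite_mem_Parts[OF assms(2)]] by simp
qed

lemma part_le_refl:
  assumes "p \<in> Parts k"
  shows "part_le k p p"
proof -
  have "join p p = p"
    using components_partition[of p] components_finest[of p p] join_refines(1)[OF assms assms]
      assms join_eq_components[OF assms assms]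
    by (intro refines_asym[of "points k"]) (auto simp: Parts_def partition_on_def)
  then show ?thesis by (simp add: part_le_def part_dist_def)
qed

definition part_less :: "(partition \<times> partition) set" where
  "part_less = {(q, p). \<exists>k. p \<in> Parts k \<and> q \<in> Parts k \<and> part_le k q p \<and> q \<noteq> p}"

lemma wf_part_less: "wf part_less"
proof -
  define rk where "rk p = card {q \<in> Parts (deg p).
    part_dist (id_part (deg p)) q < part_dist (id_part (deg p)) p}" for p
  have "rk q < rk p" if qp: "(q, p) \<in> part_less" for q p
  proof -
    obtain k where k: "p \<in> Parts k" "q \<in> Parts k" "part_le k q p" "q \<noteq> p"
      using qp by (auto simp: part_less_def)
    have "part_dist (id_part k) q < part_dist (id_part k) p"
      using part_dist_nonneg[OF k(2,1)] part_dist_eq_0[OF k(2,1)] k(3,4)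
      unfolding part_le_def by linarith
    then show ?thesis
      unfolding rk_def deg_Parts[OF k(1)] deg_Parts[OF k(2)] using k(2)
      by (intro psubset_card_mono) (auto simp: finite_Parts)
  qed
  then show ?thesis
    by (intro wf_subset[OF wf_measure[of rk]]) (auto simp: measure_def)
qed

lemma sum_part_le:
  fixes \<kappa> :: "partition \<Rightarrow> 'b::comm_monoid_add"
  assumes "p \<in> Parts k"
  shows "(\<Sum>p'\<in>{p' \<in> Parts k. part_le k p' p}. \<kappa> p') = \<kappa> p + (\<Sum>p'\<in>{p'. (p', p) \<in> part_less}. \<kappa> p')"
proof -
  have "{p' \<in> Parts k. part_le k p' p} = insert p {p'. (p', p) \<in> part_less}"
    using assms part_le_refl[OF assms] deg_Parts by (auto simp: part_less_def)
  moreover have "finite {p'. (p', p) \<in> part_less}"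
    by (rule finite_subset[OF _ finite_Parts[of k]])
      (use assms deg_Parts in \<open>auto simp: part_less_def\<close>)
  ultimately show ?thesis
    by (simp add: part_less_def)
qed

lemma is_cumulants_unique_existence:
  assumes "P_tracial_algebra scale m"
  shows "\<exists>!\<kappa>. is_cumulants scale m \<kappa>"
proof
  define K where "K = wfrec part_less
    (\<lambda>g p xs. m p xs - (\<Sum>q\<in>{q. (q, p) \<in> part_less}. g q xs))"
  have K: "K p xs = m p xs - (\<Sum>q\<in>{q. (q, p) \<in> part_less}. K q xs)" for p xs
    by (subst def_wfrec[OF K_def[THEN eq_reflection] wf_part_less])
      (simp add: cut_apply)
  define \<kappa> where "\<kappa> p xs = (if p \<in> Parts (length xs) then K p xs else 0)" for p xs
  have less_Parts: "q \<in> Parts k" if "(q, p) \<in> part_less" "p \<in> Parts k" for p q k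
    using that deg_Parts by (auto simp: part_less_def)
  have \<kappa>: "\<kappa> p xs = m p xs - (\<Sum>q\<in>{q. (q, p) \<in> part_less}. \<kappa> q xs)"
    if "p \<in> Parts (length xs)" for p xs
  proof -
    have "\<kappa> p xs = m p xs - (\<Sum>q\<in>{q. (q, p) \<in> part_less}. K q xs)"
      using that by (simp add: \<kappa>_def K[symmetric])
    also have "(\<Sum>q\<in>{q. (q, p) \<in> part_less}. K q xs) = (\<Sum>q\<in>{q. (q, p) \<in> part_less}. \<kappa> q xs)"
      using that less_Parts by (intro sum.cong) (auto simp: \<kappa>_def)
    finally show ?thesis .
  qed
  have lin: "multilinear scale m" and m0: "m {} [] = 1"
    using assms by (auto simp: P_tracial_algebra_def)
  have \<kappa>lin: "\<kappa> p (xs[i := x + y]) = \<kappa> p (xs[i := x]) + \<kappa> p (xs[i := y]) \<and>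
        \<kappa> p (xs[i := scale c x]) = c * \<kappa> p (xs[i := x])"
    if "p \<in> Parts (length xs)" "i < length xs" for p xs i x y c
    using that(1)
  proof (induction p rule: wf_induct_rule[OF wf_part_less])
    case (1 p)
    have IH: "\<kappa> q (xs[i := x + y]) = \<kappa> q (xs[i := x]) + \<kappa> q (xs[i := y])"
        "\<kappa> q (xs[i := scale c x]) = c * \<kappa> q (xs[i := x])"
      if "q \<in> {q. (q, p) \<in> part_less}" for q
      using 1 that less_Parts by blast+
    have "m p (xs[i := x + y]) = m p (xs[i := x]) + m p (xs[i := y]) \<and>
        m p (xs[i := scale c x]) = c * m p (xs[i := x])"
      using lin 1(2) \<open>i < length xs\<close> unfolding multilinear_def by blast
    then show ?case
      using 1(2)
      by (simp add: \<kappa> IH sum.distrib sum_distrib_left[symmetric] algebra_simps)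
  qed
  have no_less: "{q. (q, {}) \<in> part_less} = {}" and empty: "{} \<in> Parts 0"
  proof -
    have P0: "Parts 0 = {{}}"
      by (auto simp: Parts_def points_def partition_on_def)
    then show "{} \<in> Parts 0" by simp
    then show "{q. (q, {}) \<in> part_less} = {}"
      using less_Parts[of _ "{}" 0] P0 by (auto simp: part_less_def)
  qed
  show "is_cumulants scale m \<kappa>"
    unfolding is_cumulants_def
  proof (intro conjI allI ballI impI)
    show "multilinear scale \<kappa>"
      using \<kappa>lin unfolding multilinear_def by blast
    show "\<kappa> {} [] = 1"
      using \<kappa>[of "{}" "[]"] no_less empty m0 by simp
    show "m p xs = (\<Sum>p'\<in>{p' \<in> Parts k. part_le k p' p}. \<kappa> p' xs)"
      if "p \<in> Parts k" "length xs = k" for k p xs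
      using that by (simp add: sum_part_le \<kappa>[of p])
    show "\<kappa> p xs = 0" if "p \<notin> Parts (length xs)" for p xs
      using that by (simp add: \<kappa>_def)
  qed
  fix \<kappa>' assume \<kappa>': "is_cumulants scale m \<kappa>'"
  have "\<kappa>' p xs = \<kappa> p xs" for p xs
  proof (cases "p \<in> Parts (length xs)")
    case False
    then show ?thesis using \<kappa>' by (simp add: \<kappa>_def is_cumulants_def)
  next
    case True
    then show ?thesis
    proof (induction p rule: wf_induct_rule[OF wf_part_less])
      case (1 p)
      have "m p xs = \<kappa>' p xs + (\<Sum>q\<in>{q. (q, p) \<in> part_less}. \<kappa>' q xs)"
        using \<kappa>' 1(2) unfolding is_cumulants_def by (simp add: sum_part_le)
      moreover have "(\<Sum>q\<in>{q. (q, p) \<in> part_less}. \<kappa>' q xs) =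
          (\<Sum>q\<in>{q. (q, p) \<in> part_less}. \<kappa> q xs)"
        using 1 less_Parts by (intro sum.cong) auto
      ultimately show ?case using \<kappa>[OF 1(2)] by simp
    qed
  qed
  then show "\<kappa>' = \<kappa>" by blast
qed

end

theory Submission
  imports Defs
begin

text \<open>
  Write \<open>R\<close> for the R-transform of \<open>a 1\<close> and \<open>s\<^sub>n = a 1 + \<dots> + a n\<close>. The heart of the matter is that the
  R-transform of \<open>s\<^sub>n\<close> is the \<open>n\<close>-th \<open>\<boxplus>\<close>-power of \<open>R\<close>
  (\<open>cumulants_sum_free_copies\<close>). Expanding \<open>\<kappa>\<^sub>p(s\<^sub>n, \<dots>, s\<^sub>n)\<close> by multilinearity gives one term for each
  colouring \<open>\<epsilon>\<close> of the columns of \<open>p\<close> by \<open>1, \<dots>, n\<close>. Freeness kills the colourings that are not constant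
  on the blocks of \<open>p\<close>; for the others one permutes the columns so that equal colours become adjacent, which
  turns \<open>p\<close> into a tensor product of its extractions, and freeness gives the product of
  \<open>R\<close> over the colour classes. On the other side, the condition \<open>nc p1 + nc p2 = nc p\<close> in the
  definition of \<open>\<boxplus>\<close> says precisely that no block of \<open>p\<close> meets both \<open>I\<close> and its complement
  (\<open>nc_extractions_eq_iff\<close>), so the \<open>n\<close>-th \<open>\<boxplus>\<close>-power of \<open>R\<close> is a sum over the very same colourings
  (\<open>box_power_eq_sum_colourings\<close>).

  What remains is a computation with \<open>\<boxplus>\<close>-powers (\<open>scaled_box_power_limit\<close>). Let \<open>\<psi>\<close> be \<open>R\<close> minus the unit.
  By the binomial theorem \<open>R\<^sup>n = \<Sum>\<^sub>j (n choose j) \<psi>\<^sup>j\<close>. As \<open>R\<close> is \<open>1\<close> in degree \<open>0\<close> and \<open>0\<close> in degree \<open>1\<close>, the form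
  \<open>\<psi>\<close> starts in degree \<open>2\<close>, and so \<open>\<psi>\<^sup>j\<close> vanishes on \<open>Parts k\<close> unless \<open>2 * j \<le> k\<close>. The factor
  \<open>n\<close> to the power \<open>-k/2\<close> that comes from the normalisation therefore kills every term except \<open>2 * j = k\<close>. That
  term tends to \<open>\<psi>\<^sup>j / j!\<close>, and since each of its \<open>j\<close> factors has to use up exactly two columns, \<open>\<psi>\<close> may be replaced by its
  part of degree \<open>2\<close>. This is the value of the exponential, for which again only one term is non-zero
  (\<open>box_exp_graded_part_2\<close>).
\<close>


section \<open>Extractions and colourings of columns\<close>

lemma Parts_D:
  assumes "p \<in> Parts k"
  shows "\<Union>p = points k" "{} \<notin> p" "b \<in> p \<Longrightarrow> c \<in> p \<Longrightarrow> x \<in> b \<Longrightarrow> x \<in> c \<Longrightarrow> b = c"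
  using assms unfolding Parts_def partition_on_def disjoint_def by blast+

lemma Parts_eq_empty_iff:
  assumes "p \<in> Parts k"
  shows "p = {} \<longleftrightarrow> k = 0"
proof -
  have "p = {} \<longleftrightarrow> points k = {}" using Parts_D(1,2)[OF assms] by auto
  also have "\<dots> \<longleftrightarrow> k = 0" by (auto simp: points_def lessThan_empty_iff)
  finally show ?thesis .
qed

definition relabel :: "(nat \<Rightarrow> nat) \<Rightarrow> partition \<Rightarrow> partition" where
  "relabel f p = (`) (map_prod id f) ` p"

definition rank :: "nat set \<Rightarrow> nat \<Rightarrow> nat" where
  "rank I i = card {j \<in> I. j < i}"

text \<open>A colouring \<open>\<epsilon>\<close> of the columns splits \<open>p\<close> when the blocks of \<open>p\<close>, hence also its cycles, are
  monochromatic. A set \<open>I\<close> of columns is treated as the two-colouring \<open>\<lambda>i. i \<in> I\<close>.\<close>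

definition splits :: "partition \<Rightarrow> (nat \<Rightarrow> 'b) \<Rightarrow> bool" where
  "splits p \<epsilon> \<longleftrightarrow> (\<forall>b\<in>p. \<forall>x\<in>b. \<forall>y\<in>b. \<epsilon> (snd x) = \<epsilon> (snd y))"

lemma relabel_comp: "relabel f (relabel g p) = relabel (f \<circ> g) p"
  unfolding relabel_def image_image by (intro image_cong refl) (force simp: image_image)

lemma relabel_id: "relabel id p = p"
  by (simp add: relabel_def map_prod.id)

lemma relabel_cong:
  assumes "\<And>b x. b \<in> p \<Longrightarrow> x \<in> b \<Longrightarrow> f (snd x) = g (snd x)"
  shows "relabel f p = relabel g p"
  unfolding relabel_def
  by (intro image_cong refl) (use assms in \<open>auto simp: map_prod_def split: prod.splits\<close>)

lemma rank_bij:
  assumes "finite I"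
  shows "bij_betw (rank I) I {..<card I}"
proof -
  have inj: "inj_on (rank I) I"
  proof (rule linorder_inj_onI)
    fix i j assume "i < j" "i \<in> I" "j \<in> I"
    then have "rank I i < rank I j"
      unfolding rank_def using assms by (intro psubset_card_mono) auto
    then show "rank I i \<noteq> rank I j" by simp
  qed auto
  have "rank I ` I \<subseteq> {..<card I}"
    using assms by (auto simp: rank_def intro!: psubset_card_mono)
  moreover have "card (rank I ` I) = card {..<card I}"
    using inj by (simp add: card_image)
  ultimately have "rank I ` I = {..<card I}"
    by (intro card_subset_eq) auto
  with inj show ?thesis by (simp add: bij_betw_def)
qed

lemma rank_less_iff:
  assumes "finite I" "i \<in> I" "j \<in> I"
  shows "rank I i < rank I j \<longleftrightarrow> i < j"
proof -
  have "rank I i < rank I j" if "i < j" "i \<in> I" for i j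
    unfolding rank_def using assms that by (intro psubset_card_mono) auto
  then show ?thesis using assms by (metis less_asym linorder_neqE_nat)
qed

text \<open>The increasing numbering of a subset of \<open>J\<close> can be computed after numbering \<open>J\<close>. This makes iterated
  extractions collapse.\<close>

lemma rank_rank:
  assumes "finite J" "i \<in> J"
    and "I \<subseteq> {..<card J}"
  shows "rank I (rank J i) = rank {x \<in> J. rank J x \<in> I} i"
proof -
  have "{j \<in> I. j < rank J i} = rank J ` {x \<in> J. rank J x \<in> I \<and> x < i}"
  proof (intro equalityI subsetI)
    fix j assume j: "j \<in> {j \<in> I. j < rank J i}"
    then obtain x where "x \<in> J" "j = rank J x"
      using assms(3) rank_bij[OF assms(1)] by (auto simp: bij_betw_def)
    then show "j \<in> rank J ` {x \<in> J. rank J x \<in> I \<and> x < i}"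
      using j rank_less_iff[OF assms(1) _ assms(2)] by auto
  qed (use rank_less_iff[OF assms(1) _ assms(2)] in auto)
  moreover have "inj_on (rank J) {x \<in> J. rank J x \<in> I \<and> x < i}"
    using rank_bij[OF assms(1)] by (auto simp: bij_betw_def inj_on_def)
  ultimately have "card {j \<in> I. j < rank J i} = card {x \<in> J. rank J x \<in> I \<and> x < i}"
    by (simp only: card_image)
  moreover have "{x \<in> J. rank J x \<in> I \<and> x < i} = {j \<in> {x \<in> J. rank J x \<in> I}. j < i}" by auto
  ultimately show ?thesis by (simp only: rank_def[of I] rank_def[of "{x \<in> J. rank J x \<in> I}"])
qed

lemma rank_lessThan: "i < k \<Longrightarrow> rank {..<k} i = i"
proof -
  assume "i < k"
  then have "{j \<in> {..<k}. j < i} = {..<i}" by auto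
  then show ?thesis by (simp add: rank_def)
qed

text \<open>An extraction before its columns are renumbered. Restrictions compose by intersecting the sets of columns,
  so that most facts about extractions reduce to facts about restrictions and relabellings.\<close>

definition restriction :: "partition \<Rightarrow> nat set \<Rightarrow> partition" where
  "restriction p I = (\<inter>) (UNIV \<times> I) ` p - {{}}"

lemma extraction_eq: "extraction p I = relabel (rank I) (restriction p I)"
  unfolding extraction_def relabel_def rank_def restriction_def
  by (auto simp: Int_commute)

lemma restriction_restriction: "restriction (restriction p J) I = restriction p (J \<inter> I)"
proof -
  have "restriction (restriction p J) I = (\<inter>) (UNIV \<times> I) ` (\<inter>) (UNIV \<times> J) ` p - {{}}"
    unfolding restriction_def by blast
  also have "\<dots> = restriction p (J \<inter> I)"
    unfolding restriction_def image_image by (intro arg_cong2[of _ _ _ _ "(-)"] image_cong) auto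
  finally show ?thesis .
qed

lemma restriction_relabel:
  "restriction (relabel f p) I = relabel f (restriction p (f -` I))"
proof -
  have "UNIV \<times> I \<inter> map_prod id f ` b = map_prod id f ` (UNIV \<times> f -` I \<inter> b)" for b :: "(row \<times> nat) set"
    by auto
  then show ?thesis
    unfolding restriction_def relabel_def image_image by (auto simp: image_image)
qed

lemma mem_restriction_snd: "b \<in> restriction p I \<Longrightarrow> x \<in> b \<Longrightarrow> snd x \<in> I"
  by (auto simp: restriction_def)

lemma extraction_extraction:
  assumes "finite J" "I \<subseteq> {..<card J}"
  shows "extraction (extraction p J) I = extraction p {x \<in> J. rank J x \<in> I}"
proof -
  have "extraction (extraction p J) I = relabel (rank I \<circ> rank J) (restriction p (J \<inter> rank J -` I))"
    by (simp add: extraction_eq restriction_relabel restriction_restriction relabel_comp)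
  also have "J \<inter> rank J -` I = {x \<in> J. rank J x \<in> I}" by auto
  also have "relabel (rank I \<circ> rank J) (restriction p {x \<in> J. rank J x \<in> I}) =
      relabel (rank {x \<in> J. rank J x \<in> I}) (restriction p {x \<in> J. rank J x \<in> I})"
    using rank_rank[OF assms(1) _ assms(2)]
    by (intro relabel_cong) (auto dest: mem_restriction_snd)
  finally show ?thesis by (simp add: extraction_eq)
qed

lemma Parts_block_column: "p \<in> Parts k \<Longrightarrow> b \<in> p \<Longrightarrow> x \<in> b \<Longrightarrow> snd x < k"
proof -
  assume "p \<in> Parts k" "b \<in> p" "x \<in> b"
  then have "x \<in> points k" unfolding Parts_def partition_on_def by blast
  then show "snd x < k" by (auto simp: points_def)
qed

lemma restriction_id:
  assumes "p \<in> Parts k"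
  shows "restriction p {..<k} = p"
proof -
  have "UNIV \<times> {..<k} \<inter> b = b" if "b \<in> p" for b
    using Parts_block_column[OF assms that] by auto
  then have "(\<inter>) (UNIV \<times> {..<k}) ` p = p" by (auto simp: image_iff)
  then show ?thesis using assms by (auto simp: restriction_def Parts_def partition_on_def)
qed

lemma extraction_lessThan:
  assumes "p \<in> Parts k"
  shows "extraction p {..<k} = p"
proof -
  have "relabel (rank {..<k}) p = relabel id p"
    using Parts_block_column[OF assms] rank_lessThan by (intro relabel_cong) auto
  then show ?thesis by (simp add: extraction_eq restriction_id[OF assms] relabel_id)
qed

lemma relabel_partition_on:
  assumes "partition_on (R \<times> I) p" "inj_on f I"
  shows "partition_on (R \<times> f ` I) (relabel f p)"
proof -
  have "inj_on (map_prod id f) (R \<times> I)"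
    using assms(2) by (auto simp: inj_on_def)
  moreover have image_eq: "map_prod id f ` (R \<times> I) = R \<times> f ` I" by force
  ultimately
  have "partition_on (R \<times> f ` I) (relabel f p - {{}})"
    using partition_on_inj_image[OF assms(1)] unfolding relabel_def by metis
  moreover have "{} \<notin> relabel f p"
    using assms(1) by (auto simp: relabel_def partition_on_def)
  ultimately show ?thesis by simp
qed

lemma restriction_partition_on:
  assumes "p \<in> Parts k" "I \<subseteq> {..<k}"
  shows "partition_on ({Top, Bot} \<times> I) (restriction p I)"
proof -
  have "partition_on (points k) p" using assms by (simp add: Parts_def)
  from partition_on_restrict[OF this, of "UNIV \<times> I"]
  show ?thesis
    using assms(2) unfolding restriction_def points_def
    by (simp add: Times_Int_Times inf_absorb1)
qed

lemma extraction_Parts: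
  assumes "p \<in> Parts k" "I \<subseteq> {..<k}"
  shows "extraction p I \<in> Parts (card I)"
proof -
  have "finite I" using assms(2) finite_subset by blast
  then show ?thesis
    using relabel_partition_on[OF restriction_partition_on[OF assms], of "rank I"] rank_bij[of I]
    by (simp add: extraction_eq Parts_def points_def bij_betw_def)
qed

text \<open>Distinct blocks have disjoint traces on \<open>I\<close>, so the blocks of the extraction correspond to the blocks of
  \<open>p\<close> that meet \<open>I\<close>.\<close>

lemma nc_extraction:
  assumes "p \<in> Parts k" "I \<subseteq> {..<k}"
  shows "nc (extraction p I) = card {b \<in> p. \<exists>x\<in>b. snd x \<in> I}"
proof -
  have fin: "finite I" using assms(2) finite_subset by blast
  have "restriction p I = (\<inter>) (UNIV \<times> I) ` {b \<in> p. \<exists>x\<in>b. snd x \<in> I}"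
  proof -
    have "UNIV \<times> I \<inter> b \<noteq> {} \<longleftrightarrow> (\<exists>x\<in>b. snd x \<in> I)" for b :: "(row \<times> nat) set"
      by (fastforce simp: disjoint_iff mem_Times_iff)
    moreover have "restriction p I = (\<inter>) (UNIV \<times> I) ` {b \<in> p. UNIV \<times> I \<inter> b \<noteq> {}}"
      unfolding restriction_def by auto
    ultimately show ?thesis by simp
  qed
  moreover have "inj_on ((\<inter>) (UNIV \<times> I)) {b \<in> p. \<exists>x\<in>b. snd x \<in> I}"
  proof (rule inj_onI)
    fix b c assume *: "b \<in> {b \<in> p. \<exists>x\<in>b. snd x \<in> I}" "c \<in> {b \<in> p. \<exists>x\<in>b. snd x \<in> I}"
      "UNIV \<times> I \<inter> b = UNIV \<times> I \<inter> c"
    then obtain x where "x \<in> b" "snd x \<in> I" by auto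
    then have "x \<in> UNIV \<times> I \<inter> b" by (auto simp: mem_Times_iff)
    then have "x \<in> c" using *(3) by blast
    then show "b = c"
      using * \<open>x \<in> b\<close> assms(1) unfolding Parts_def partition_on_def disjoint_def by blast
  qed
  ultimately have 1: "card (restriction p I) = card {b \<in> p. \<exists>x\<in>b. snd x \<in> I}"
    by (simp add: card_image)
  have "inj_on (map_prod id (rank I)) ({Top, Bot} \<times> I)"
    using rank_bij[OF fin] by (auto simp: inj_on_def bij_betw_def)
  then have "inj_on ((`) (map_prod id (rank I))) (Pow ({Top, Bot} \<times> I))"
    by (rule inj_on_image_Pow)
  then have "inj_on ((`) (map_prod id (rank I))) (restriction p I)"
    by (rule inj_on_subset) (use restriction_partition_on[OF assms] in \<open>auto simp: partition_on_def\<close>)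
  then show ?thesis
    unfolding nc_def extraction_eq relabel_def using 1 by (simp add: card_image)
qed

text \<open>By the preceding count the left side exceeds \<open>nc p\<close> by the number of blocks that meet both \<open>I\<close> and its
  complement.\<close>

lemma nc_extractions_eq_iff:
  assumes "p \<in> Parts k" "I \<subseteq> {..<k}"
  shows "nc (extraction p I) + nc (extraction p ({..<k} - I)) = nc p \<longleftrightarrow> splits p (\<lambda>i. i \<in> I)"
proof -
  let ?A = "{b \<in> p. \<exists>x\<in>b. snd x \<in> I}" and ?B = "{b \<in> p. \<exists>x\<in>b. snd x \<in> {..<k} - I}"
  have fin: "finite p" using finite_mem_Parts assms(1) .
  have "{} \<notin> p" using assms(1) by (auto simp: Parts_def partition_on_def)
  have un: "p = ?A \<union> ?B"
  proof -
    have "b \<in> ?A \<union> ?B" if b: "b \<in> p" for b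
    proof -
      obtain x where "x \<in> b" using b \<open>{} \<notin> p\<close> by (metis all_not_in_conv)
      then show ?thesis using b Parts_block_column[OF assms(1) b] by blast
    qed
    then show ?thesis by auto
  qed
  have "card ?A + card ?B = card (?A \<union> ?B) + card (?A \<inter> ?B)"
    by (rule card_Un_Int) (use fin in auto)
  then have "nc (extraction p I) + nc (extraction p ({..<k} - I)) = nc p \<longleftrightarrow> card (?A \<inter> ?B) = 0"
    using nc_extraction[OF assms] nc_extraction[OF assms(1), of "{..<k} - I"] un
    by (simp add: nc_def)
  also have "\<dots> \<longleftrightarrow> ?A \<inter> ?B = {}" using fin by simp
  also have "\<dots> \<longleftrightarrow> splits p (\<lambda>i. i \<in> I)"
    unfolding splits_def using Parts_block_column[OF assms(1)] by blast
  finally show ?thesis .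
qed

text \<open>The members of \<open>F2 p\<close> are determined by their third component, which turns the sum over \<open>F2 p\<close> into a sum
  over two-colourings.\<close>

lemma boxplus_eq:
  assumes "p \<in> Parts k"
  shows "boxplus \<phi> \<psi> p = (\<Sum>I | I \<subseteq> {..<k} \<and> splits p (\<lambda>i. i \<in> I).
    \<phi> (extraction p I) * \<psi> (extraction p ({..<k} - I)))"
proof -
  have "F2 p = (\<lambda>I. (extraction p I, extraction p ({..<k} - I), I)) `
      {I. I \<subseteq> {..<k} \<and> splits p (\<lambda>i. i \<in> I)}"
    using nc_extractions_eq_iff[OF assms] by (auto simp: F2_def deg_Parts[OF assms])
  then show ?thesis
    unfolding boxplus_def by (simp add: sum.reindex inj_on_def)
qed

lemma splits_relabel: "splits (relabel f p) \<epsilon> \<longleftrightarrow> splits p (\<epsilon> \<circ> f)"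
  unfolding splits_def relabel_def by simp

lemma splits_restriction_iff:
  "splits (restriction p J) \<epsilon> \<longleftrightarrow>
     (\<forall>b\<in>p. \<forall>x\<in>b. \<forall>y\<in>b. snd x \<in> J \<longrightarrow> snd y \<in> J \<longrightarrow> \<epsilon> (snd x) = \<epsilon> (snd y))"
proof (intro iffI ballI impI)
  fix b x y
  assume *: "splits (restriction p J) \<epsilon>" "b \<in> p" "x \<in> b" "y \<in> b" "snd x \<in> J" "snd y \<in> J"
  then have "x \<in> UNIV \<times> J \<inter> b" "y \<in> UNIV \<times> J \<inter> b" by (auto simp: mem_Times_iff)
  moreover from this have "UNIV \<times> J \<inter> b \<in> restriction p J"
    unfolding restriction_def using *(2) by auto
  ultimately show "\<epsilon> (snd x) = \<epsilon> (snd y)"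
    using *(1) unfolding splits_def by (metis (no_types, lifting))
next
  assume R: "\<forall>b\<in>p. \<forall>x\<in>b. \<forall>y\<in>b. snd x \<in> J \<longrightarrow> snd y \<in> J \<longrightarrow> \<epsilon> (snd x) = \<epsilon> (snd y)"
  show "splits (restriction p J) \<epsilon>"
    unfolding splits_def
  proof (intro ballI)
    fix c x y assume c: "c \<in> restriction p J" "x \<in> c" "y \<in> c"
    then obtain b where "b \<in> p" "c = UNIV \<times> J \<inter> b" unfolding restriction_def by auto
    then show "\<epsilon> (snd x) = \<epsilon> (snd y)"
      using R c mem_restriction_snd[OF c(1)] by (metis IntD2)
  qed
qed

text \<open>The form of the previous sum in which subsets of the columns of the extraction are pulled back to
  subsets of \<open>J\<close>. It keeps all columns numbered as in \<open>p\<close> while \<open>\<boxplus>\<close> is iterated.\<close>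

lemma boxplus_extraction:
  assumes "p \<in> Parts k" "J \<subseteq> {..<k}"
  shows "boxplus \<phi> \<psi> (extraction p J) = (\<Sum>I | I \<subseteq> J \<and> splits (restriction p J) (\<lambda>i. i \<in> I).
    \<phi> (extraction p I) * \<psi> (extraction p (J - I)))"
proof -
  have fin: "finite J" using assms(2) finite_subset by blast
  \<comment> \<open>Pulling back along the numbering of \<open>J\<close> is inverse to taking images under it.\<close>
  let ?f = "\<lambda>I. {x \<in> J. rank J x \<in> I}"
  have bij: "inj_on (rank J) J" "rank J ` J = {..<card J}"
    using rank_bij[OF fin] by (auto simp: bij_betw_def)
  have split: "splits (extraction p J) (\<lambda>i. i \<in> I) \<longleftrightarrow> splits (restriction p J) (\<lambda>i. i \<in> ?f I)" for I
    unfolding extraction_eq splits_relabel comp_def splits_restriction_iff by auto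
  have rank_f: "rank J ` ?f I = I" if "I \<subseteq> {..<card J}" for I
    using that bij(2) by auto
  have f_rank: "?f (rank J ` I) = I" if "I \<subseteq> J" for I
    using that inj_on_image_mem_iff[OF bij(1)] by auto
  have "boxplus \<phi> \<psi> (extraction p J) = (\<Sum>I | I \<subseteq> {..<card J} \<and> splits (extraction p J) (\<lambda>i. i \<in> I).
      \<phi> (extraction (extraction p J) I) * \<psi> (extraction (extraction p J) ({..<card J} - I)))"
    by (rule boxplus_eq[OF extraction_Parts[OF assms]])
  also have "\<dots> = (\<Sum>I | I \<subseteq> J \<and> splits (restriction p J) (\<lambda>i. i \<in> I).
      \<phi> (extraction p I) * \<psi> (extraction p (J - I)))"
  proof (rule sum.reindex_bij_witness[where i = "(`) (rank J)" and j = ?f])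
    fix I assume "I \<in> {I. I \<subseteq> {..<card J} \<and> splits (extraction p J) (\<lambda>i. i \<in> I)}"
    then have I: "I \<subseteq> {..<card J}" "splits (extraction p J) (\<lambda>i. i \<in> I)" by auto
    show "rank J ` ?f I = I" by (rule rank_f[OF I(1)])
    show "?f I \<in> {I. I \<subseteq> J \<and> splits (restriction p J) (\<lambda>i. i \<in> I)}" using I(2) split by auto
    have "?f ({..<card J} - I) = J - ?f I" using bij(2) by auto
    then show "\<phi> (extraction p (?f I)) * \<psi> (extraction p (J - ?f I)) =
        \<phi> (extraction (extraction p J) I) * \<psi> (extraction (extraction p J) ({..<card J} - I))"
      using extraction_extraction[OF fin I(1), of p] extraction_extraction[OF fin, of "{..<card J} - I" p]
      by simp
  next
    fix I assume "I \<in> {I. I \<subseteq> J \<and> splits (restriction p J) (\<lambda>i. i \<in> I)}"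
    then have I: "I \<subseteq> J" "splits (restriction p J) (\<lambda>i. i \<in> I)" by auto
    show "?f (rank J ` I) = I" by (rule f_rank[OF I(1)])
    show "rank J ` I \<in> {I. I \<subseteq> {..<card J} \<and> splits (extraction p J) (\<lambda>i. i \<in> I)}"
    proof (intro CollectI conjI)
      show "rank J ` I \<subseteq> {..<card J}" using I(1) unfolding bij(2)[symmetric] by (rule image_mono)
      show "splits (extraction p J) (\<lambda>i. i \<in> rank J ` I)"
        unfolding split f_rank[OF I(1)] by (rule I(2))
    qed
  qed
  finally show ?thesis .
qed


section \<open>Powers for the boxed sum\<close>

lemma box_power_Suc: "box_power \<phi> (Suc n) p = boxplus \<phi> (box_power \<phi> n) p"
  by (simp add: box_power_def)

text \<open>A colouring with \<open>n + 1\<close> colours amounts to the class \<open>I\<close> of the last colour together with a colouring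
  of the other columns with \<open>n\<close> colours, and it splits \<open>p\<close> iff both \<open>I\<close> and the smaller colouring do. The
  statement is about all sets \<open>J\<close> of columns because the induction removes \<open>I\<close> from \<open>J\<close>.\<close>

lemma box_power_extraction:
  assumes "p \<in> Parts k" "J \<subseteq> {..<k}"
  shows "box_power \<phi> n (extraction p J) = (\<Sum>\<epsilon> | \<epsilon> \<in> J \<rightarrow>\<^sub>E {1..n} \<and> splits (restriction p J) \<epsilon>.
    \<Prod>j=1..n. \<phi> (extraction p {i \<in> J. \<epsilon> i = j}))"
  using assms(2)
proof (induction n arbitrary: J)
  case 0
  have fin: "finite J" using 0 finite_subset by blast
  show ?case
  proof (cases "J = {}")
    case True
    then have "{\<epsilon>. \<epsilon> \<in> J \<rightarrow>\<^sub>E {1..0::nat} \<and> splits (restriction p J) \<epsilon>} = {\<lambda>_. undefined}"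
      by (auto simp: splits_restriction_iff)
    moreover have "extraction p J = {}"
      using Parts_eq_empty_iff[OF extraction_Parts[OF assms(1) 0]] True by simp
    ultimately show ?thesis by (simp add: box_power_def box_unit_def)
  next
    case False
    then have "J \<rightarrow>\<^sub>E {1..0::nat} = {}" by (auto simp: PiE_eq_empty_iff)
    then show ?thesis
      using Parts_eq_empty_iff[OF extraction_Parts[OF assms(1) 0]] False fin
      by (simp add: box_power_def box_unit_def)
  qed
next
  case (Suc n)
  have fin: "finite J" using Suc.prems finite_subset by blast
  let ?S = "\<lambda>I. {\<epsilon>. \<epsilon> \<in> (J - I) \<rightarrow>\<^sub>E {1..n} \<and> splits (restriction p (J - I)) \<epsilon>}"
  let ?T = "{I. I \<subseteq> J \<and> splits (restriction p J) (\<lambda>i. i \<in> I)}"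
  let ?P = "\<lambda>I \<epsilon>. \<Prod>j=1..n. \<phi> (extraction p {i \<in> J - I. \<epsilon> i = j})"
  have finT: "finite ?T" by (rule finite_subset[of _ "Pow J"]) (use fin in auto)
  have finS: "finite (?S I)" for I
    by (rule finite_subset[of _ "(J - I) \<rightarrow>\<^sub>E {1..n}"]) (use fin in \<open>auto intro!: finite_PiE\<close>)
  have "box_power \<phi> (Suc n) (extraction p J) =
      (\<Sum>I\<in>?T. \<phi> (extraction p I) * box_power \<phi> n (extraction p (J - I)))"
    unfolding box_power_Suc by (rule boxplus_extraction[OF assms(1) Suc.prems])
  also have "\<dots> = (\<Sum>I\<in>?T. \<phi> (extraction p I) * (\<Sum>\<epsilon>\<in>?S I. ?P I \<epsilon>))"
    using Suc by (intro sum.cong refl arg_cong2[of _ _ _ _ "(*)"] Suc.IH) auto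
  also have "\<dots> = (\<Sum>(I, \<epsilon>)\<in>Sigma ?T ?S. \<phi> (extraction p I) * ?P I \<epsilon>)"
    using finT finS by (simp add: sum_distrib_left sum.Sigma)
  also have "\<dots> = (\<Sum>\<epsilon> | \<epsilon> \<in> J \<rightarrow>\<^sub>E {1..Suc n} \<and> splits (restriction p J) \<epsilon>.
      \<Prod>j=1..Suc n. \<phi> (extraction p {i \<in> J. \<epsilon> i = j}))"
  proof (rule sum.reindex_bij_witness[where
        \<comment> \<open>The first component collects the columns of the last colour \<open>Suc n\<close>; the second is the colouring of the rest.\<close>
        i = "\<lambda>\<epsilon>. ({i \<in> J. \<epsilon> i = Suc n}, \<lambda>i\<in>J - {i \<in> J. \<epsilon> i = Suc n}. \<epsilon> i)" and
        j = "\<lambda>(I, \<epsilon>) i. if i \<in> I then Suc n else \<epsilon> i"])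
    fix x assume "x \<in> Sigma ?T ?S"
    then obtain I \<epsilon> where x: "x = (I, \<epsilon>)" and I: "I \<subseteq> J" "splits (restriction p J) (\<lambda>i. i \<in> I)"
      and \<epsilon>: "\<epsilon> \<in> (J - I) \<rightarrow>\<^sub>E {1..n}" "splits (restriction p (J - I)) \<epsilon>" by blast
    let ?e = "\<lambda>i. if i \<in> I then Suc n else \<epsilon> i"
    have le: "\<epsilon> i \<in> {1..n}" if "i \<in> J" "i \<notin> I" for i
      using PiE_mem[OF \<epsilon>(1)] that by blast
    have e: "(case x of (I, \<epsilon>) \<Rightarrow> \<lambda>i. if i \<in> I then Suc n else \<epsilon> i) = ?e" by (simp add: x)
    have "\<epsilon> i \<noteq> Suc n" if "i \<in> J" "i \<notin> I" for i
      using le[OF that] by auto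
    then have lev: "{i \<in> J. ?e i = Suc n} = I" using I(1) by auto
    have lev': "{i \<in> J. ?e i = j} = {i \<in> J - I. \<epsilon> i = j}" if "j \<in> {1..n}" for j
      using that by auto
    show "({i \<in> J. (case x of (I, \<epsilon>) \<Rightarrow> \<lambda>i. if i \<in> I then Suc n else \<epsilon> i) i = Suc n},
        \<lambda>i\<in>J - {i \<in> J. (case x of (I, \<epsilon>) \<Rightarrow> \<lambda>i. if i \<in> I then Suc n else \<epsilon> i) i = Suc n}.
          (case x of (I, \<epsilon>) \<Rightarrow> \<lambda>i. if i \<in> I then Suc n else \<epsilon> i) i) = x"
      unfolding e lev unfolding x
      using PiE_arb[OF \<epsilon>(1)] by (auto simp: restrict_def fun_eq_iff)
    have "?e \<in> J \<rightarrow>\<^sub>E {1..Suc n}"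
    proof (rule PiE_I)
      fix i assume "i \<in> J" then show "?e i \<in> {1..Suc n}" using le[of i] by auto
    next
      fix i assume "i \<notin> J" then show "?e i = undefined" using I(1) PiE_arb[OF \<epsilon>(1), of i] by auto
    qed
    moreover have "splits (restriction p J) ?e"
      unfolding splits_restriction_iff
    proof (intro ballI impI)
      fix b x y assume *: "b \<in> p" "x \<in> b" "y \<in> b" "snd x \<in> J" "snd y \<in> J"
      then have "snd x \<in> I \<longleftrightarrow> snd y \<in> I"
        using I(2) unfolding splits_restriction_iff by blast
      moreover have "\<epsilon> (snd x) = \<epsilon> (snd y)" if "snd x \<notin> I" "snd y \<notin> I"
        using \<epsilon>(2) * that unfolding splits_restriction_iff by blast
      ultimately show "?e (snd x) = ?e (snd y)" by simp
    qed
    ultimately show "(case x of (I, \<epsilon>) \<Rightarrow> \<lambda>i. if i \<in> I then Suc n else \<epsilon> i) \<in>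
        {\<epsilon>. \<epsilon> \<in> J \<rightarrow>\<^sub>E {1..Suc n} \<and> splits (restriction p J) \<epsilon>}"
      unfolding e by simp
    have "(\<Prod>j=1..Suc n. \<phi> (extraction p {i \<in> J. ?e i = j})) = ?P I \<epsilon> * \<phi> (extraction p I)"
      using lev lev' by simp
    then show "(\<Prod>j=1..Suc n. \<phi> (extraction p
          {i \<in> J. (case x of (I, \<epsilon>) \<Rightarrow> \<lambda>i. if i \<in> I then Suc n else \<epsilon> i) i = j})) =
        (case x of (I, \<epsilon>) \<Rightarrow> \<phi> (extraction p I) * ?P I \<epsilon>)"
      unfolding e unfolding x by simp
  next
    fix \<epsilon> assume "\<epsilon> \<in> {\<epsilon>. \<epsilon> \<in> J \<rightarrow>\<^sub>E {1..Suc n} \<and> splits (restriction p J) \<epsilon>}"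
    then have \<epsilon>: "\<epsilon> \<in> J \<rightarrow>\<^sub>E {1..Suc n}" "splits (restriction p J) \<epsilon>" by auto
    let ?I = "{i \<in> J. \<epsilon> i = Suc n}"
    show "(case (?I, \<lambda>i\<in>J - ?I. \<epsilon> i) of (I, \<epsilon>) \<Rightarrow> \<lambda>i. if i \<in> I then Suc n else \<epsilon> i) = \<epsilon>"
      using PiE_arb[OF \<epsilon>(1)] by (auto simp: fun_eq_iff)
    have "(\<lambda>i\<in>J - ?I. \<epsilon> i) \<in> (J - ?I) \<rightarrow>\<^sub>E {1..n}"
    proof (intro restrict_PiE[THEN iffD2] Pi_I)
      fix i assume i: "i \<in> J - ?I"
      then have "\<epsilon> i \<in> {1..Suc n}" using PiE_mem[OF \<epsilon>(1)] by blast
      then show "\<epsilon> i \<in> {1..n}" using i by auto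
    qed
    moreover have "splits (restriction p (J - ?I)) (\<lambda>i\<in>J - ?I. \<epsilon> i)"
      "splits (restriction p J) (\<lambda>i. i \<in> ?I)"
    proof -
      have same: "\<epsilon> (snd x) = \<epsilon> (snd y)" if "b \<in> p" "x \<in> b" "y \<in> b" "snd x \<in> J" "snd y \<in> J" for b x y
        using \<epsilon>(2) that unfolding splits_restriction_iff by blast
      show "splits (restriction p (J - ?I)) (\<lambda>i\<in>J - ?I. \<epsilon> i)"
        unfolding splits_restriction_iff
      proof (intro ballI impI)
        fix b x y assume *: "b \<in> p" "x \<in> b" "y \<in> b" "snd x \<in> J - ?I" "snd y \<in> J - ?I"
        then show "(\<lambda>i\<in>J - ?I. \<epsilon> i) (snd x) = (\<lambda>i\<in>J - ?I. \<epsilon> i) (snd y)"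
          using same[OF *(1-3)] by simp
      qed
      show "splits (restriction p J) (\<lambda>i. i \<in> ?I)"
        unfolding splits_restriction_iff
      proof (intro ballI impI)
        fix b x y assume *: "b \<in> p" "x \<in> b" "y \<in> b" "snd x \<in> J" "snd y \<in> J"
        then show "(snd x \<in> ?I) = (snd y \<in> ?I)"
          using same[OF *] by simp
      qed
    qed
    ultimately show "(?I, \<lambda>i\<in>J - ?I. \<epsilon> i) \<in> Sigma ?T ?S"
      by (intro SigmaI CollectI conjI) simp_all
  qed
  finally show ?case .
qed

lemma box_power_eq_sum_colourings:
  assumes "p \<in> Parts k"
  shows "box_power \<phi> n p = (\<Sum>\<epsilon> | \<epsilon> \<in> {..<k} \<rightarrow>\<^sub>E {1..n} \<and> splits p \<epsilon>.
    \<Prod>j=1..n. \<phi> (extraction p {i. i < k \<and> \<epsilon> i = j}))"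
  using box_power_extraction[OF assms order_refl, of \<phi> n]
  by (simp add: extraction_lessThan[OF assms] restriction_id[OF assms])

lemma boxplus_cong:
  assumes "p \<in> Parts k"
    and "\<And>I. I \<subseteq> {..<k} \<Longrightarrow> \<phi> (extraction p I) * \<psi> (extraction p ({..<k} - I)) =
      \<phi>' (extraction p I) * \<psi>' (extraction p ({..<k} - I))"
  shows "boxplus \<phi> \<psi> p = boxplus \<phi>' \<psi>' p"
  unfolding boxplus_eq[OF assms(1)] using assms(2) by (intro sum.cong) auto

text \<open>The unit vanishes on an extraction unless no column was extracted, so a single two-colouring contributes.\<close>

lemma boxplus_unit:
  assumes "p \<in> Parts k"
  shows boxplus_unit_left: "boxplus box_unit \<psi> p = \<psi> p"
    and boxplus_unit_right: "boxplus \<psi> box_unit p = \<psi> p"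
proof -
  have fin: "finite {I. I \<subseteq> {..<k} \<and> splits p (\<lambda>i. i \<in> I)}"
    by (rule finite_subset[of _ "Pow {..<k}"]) auto
  have unit: "box_unit (extraction p I) = (if I = {} then 1 else 0)" if "I \<subseteq> {..<k}" for I
  proof -
    have "finite I" using that finite_subset by blast
    then show ?thesis
      using Parts_eq_empty_iff[OF extraction_Parts[OF assms that]] by (auto simp: box_unit_def)
  qed
  have "boxplus box_unit \<psi> p = (\<Sum>I | I \<subseteq> {..<k} \<and> splits p (\<lambda>i. i \<in> I). if I = {} then \<psi> p else 0)"
    unfolding boxplus_eq[OF assms]
    by (intro sum.cong) (auto simp: unit extraction_lessThan[OF assms])
  then show "boxplus box_unit \<psi> p = \<psi> p"
    using fin by (simp add: splits_def)
  have "boxplus \<psi> box_unit p = (\<Sum>I | I \<subseteq> {..<k} \<and> splits p (\<lambda>i. i \<in> I). if I = {..<k} then \<psi> p else 0)"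
    unfolding boxplus_eq[OF assms]
    by (intro sum.cong) (auto simp: unit extraction_lessThan[OF assms])
  moreover have "splits p (\<lambda>i. i \<in> {..<k})"
    unfolding splits_def using Parts_block_column[OF assms] by simp
  ultimately show "boxplus \<psi> box_unit p = \<psi> p"
    using fin by simp
qed

text \<open>Powers are iterates of left multiplication, and left multiplication by \<open>\<phi>\<close> is the identity plus left
  multiplication by \<open>\<psi>\<close>. These two operators commute, so that their sum obeys the binomial theorem.\<close>

lemma box_power_binomial:
  assumes "\<And>p. \<phi> p = box_unit p + \<psi> p" "p \<in> Parts k"
  shows "box_power \<phi> n p = (\<Sum>j\<le>n. of_nat (n choose j) * box_power \<psi> j p)"
  using assms(2)
proof (induction n arbitrary: p k)
  case 0
  then show ?case by (simp add: box_power_def)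
next
  case (Suc n)
  let ?X = "\<lambda>j. box_power \<psi> j p"
  have "box_power \<phi> (Suc n) p = boxplus box_unit (box_power \<phi> n) p + boxplus \<psi> (box_power \<phi> n) p"
    unfolding box_power_Suc boxplus_eq[OF Suc.prems] assms(1) by (simp add: distrib_right sum.distrib)
  also have "boxplus box_unit (box_power \<phi> n) p = (\<Sum>j\<le>n. of_nat (n choose j) * ?X j)"
    by (simp add: boxplus_unit_left[OF Suc.prems] Suc.IH[OF Suc.prems])
  also have "boxplus \<psi> (box_power \<phi> n) p = (\<Sum>j\<le>n. of_nat (n choose j) * ?X (Suc j))"
  proof -
    have "boxplus \<psi> (box_power \<phi> n) p = (\<Sum>I | I \<subseteq> {..<k} \<and> splits p (\<lambda>i. i \<in> I).
        \<Sum>j\<le>n. of_nat (n choose j) * (\<psi> (extraction p I) * box_power \<psi> j (extraction p ({..<k} - I))))"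
      unfolding boxplus_eq[OF Suc.prems]
    proof (rule sum.cong[OF refl])
      fix I
      have "extraction p ({..<k} - I) \<in> Parts (card ({..<k} - I))"
        by (rule extraction_Parts[OF Suc.prems]) auto
      from Suc.IH[OF this]
      show "\<psi> (extraction p I) * box_power \<phi> n (extraction p ({..<k} - I)) =
        (\<Sum>j\<le>n. of_nat (n choose j) * (\<psi> (extraction p I) * box_power \<psi> j (extraction p ({..<k} - I))))"
        by (simp add: sum_distrib_left mult.left_commute)
    qed
    also have "\<dots> = (\<Sum>j\<le>n. of_nat (n choose j) * ?X (Suc j))"
      unfolding box_power_Suc boxplus_eq[OF Suc.prems] by (subst sum.swap) (simp add: sum_distrib_left)
    finally show ?thesis .
  qed
  also have "(\<Sum>j\<le>n. of_nat (n choose j) * ?X j) + (\<Sum>j\<le>n. of_nat (n choose j) * ?X (Suc j)) =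
      (\<Sum>j\<le>Suc n. of_nat (Suc n choose j) * ?X j)"
  proof -
    have "(\<Sum>j\<le>n. of_nat (n choose j) * ?X j) = (\<Sum>j\<le>Suc n. of_nat (n choose j) * ?X j)" by simp
    also have "\<dots> = ?X 0 + (\<Sum>j\<le>n. of_nat (n choose Suc j) * ?X (Suc j))"
      by (subst sum.atMost_Suc_shift) simp
    finally have lhs: "(\<Sum>j\<le>n. of_nat (n choose j) * ?X j) = ?X 0 + (\<Sum>j\<le>n. of_nat (n choose Suc j) * ?X (Suc j))" .
    have "(\<Sum>j\<le>Suc n. of_nat (Suc n choose j) * ?X j) = ?X 0 + (\<Sum>j\<le>n. of_nat (Suc n choose Suc j) * ?X (Suc j))"
      by (subst sum.atMost_Suc_shift) simp
    then show ?thesis unfolding lhs by (simp add: distrib_right sum.distrib)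
  qed
  finally show ?case .
qed

text \<open>Each of the \<open>j\<close> factors uses up at least two columns.\<close>

lemma box_power_eq_0:
  assumes "\<And>k p. p \<in> Parts k \<Longrightarrow> k < 2 \<Longrightarrow> \<psi> p = 0" "p \<in> Parts k" "k < 2 * j"
  shows "box_power \<psi> j p = 0"
  using assms(2,3)
proof (induction j arbitrary: p k)
  case (Suc j)
  have vanish: "\<psi> (extraction p I) * box_power \<psi> j (extraction p ({..<k} - I)) = 0" if I: "I \<subseteq> {..<k}" for I
  proof (cases "card I < 2")
    case True
    then show ?thesis using assms(1)[OF extraction_Parts[OF Suc.prems(1) I]] by simp
  next
    case False
    moreover have "card ({..<k} - I) = k - card I" "card I \<le> k"
      using I card_mono[OF _ I] by (simp_all add: card_Diff_subset finite_subset)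
    ultimately have "card ({..<k} - I) < 2 * j" using Suc.prems(2) by simp
    then show ?thesis using Suc.IH[OF extraction_Parts[OF Suc.prems(1)]] by simp
  qed
  show ?case
    unfolding box_power_Suc boxplus_eq[OF Suc.prems(1)] by (rule sum.neutral) (use vanish in blast)
qed simp

text \<open>If there are only \<open>2 * j\<close> columns for \<open>j\<close> factors, each factor gets exactly two of them: more for one factor
  would leave too few for the others.\<close>

lemma box_power_cong_Parts_2:
  assumes "\<And>k p. p \<in> Parts k \<Longrightarrow> k < 2 \<Longrightarrow> \<psi> p = 0" "\<And>k p. p \<in> Parts k \<Longrightarrow> k < 2 \<Longrightarrow> \<chi> p = 0"
    and "\<And>p. p \<in> Parts 2 \<Longrightarrow> \<psi> p = \<chi> p"
    and "p \<in> Parts (2 * j)"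
  shows "box_power \<psi> j p = box_power \<chi> j p"
  using assms(4)
proof (induction j arbitrary: p)
  case 0
  then show ?case by (simp add: box_power_def)
next
  case (Suc j)
  show ?case
    unfolding box_power_Suc
  proof (rule boxplus_cong[OF Suc.prems])
    fix I assume I: "I \<subseteq> {..<2 * Suc j}"
    let ?J = "{..<2 * Suc j} - I"
    have card: "card ?J = 2 * Suc j - card I"
      using I by (simp add: card_Diff_subset finite_subset)
    have PI: "extraction p I \<in> Parts (card I)" and PJ: "extraction p ?J \<in> Parts (card ?J)"
      using I by (auto intro!: extraction_Parts[OF Suc.prems])
    \<comment> \<open>With fewer than two columns in \<open>I\<close> the first factor vanishes, with more than two the second one does.\<close>
    consider "card I < 2" | "card I = 2" | "card I > 2" by linarith
    then show "\<psi> (extraction p I) * box_power \<psi> j (extraction p ?J) =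
      \<chi> (extraction p I) * box_power \<chi> j (extraction p ?J)"
    proof cases
      case 1
      then show ?thesis using assms(1,2)[OF PI] by simp
    next
      case 2
      then show ?thesis using assms(3) PI PJ card Suc.IH by simp
    next
      case 3
      then have "card ?J < 2 * j \<or> j = 0" using card by auto
      then have "card ?J < 2 * j" using 3 I subset_eq_atLeast0_lessThan_card[of I "2 * Suc j"]
        by (auto simp: lessThan_atLeast0)
      then show ?thesis using box_power_eq_0[OF assms(1) PJ] box_power_eq_0[OF assms(2) PJ] by simp
    qed
  qed
qed

lemma box_power_homogeneous:
  assumes "\<And>k p. p \<in> Parts k \<Longrightarrow> k \<noteq> 2 \<Longrightarrow> \<chi> p = 0" "p \<in> Parts k" "k \<noteq> 2 * j"
  shows "box_power \<chi> j p = 0"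
  using assms(2,3)
proof (induction j arbitrary: p k)
  case 0
  then show ?case using Parts_eq_empty_iff[of p k] by (auto simp: box_power_def box_unit_def)
next
  case (Suc j)
  have vanish: "\<chi> (extraction p I) * box_power \<chi> j (extraction p ({..<k} - I)) = 0" if I: "I \<subseteq> {..<k}" for I
  proof (cases "card I = 2")
    case False
    then show ?thesis using assms(1)[OF extraction_Parts[OF Suc.prems(1) I]] by simp
  next
    case True
    moreover have "card ({..<k} - I) = k - card I" "card I \<le> k"
      using I card_mono[OF _ I] by (simp_all add: card_Diff_subset finite_subset)
    ultimately have "card ({..<k} - I) \<noteq> 2 * j" using Suc.prems(2) by simp
    then show ?thesis using Suc.IH[OF extraction_Parts[OF Suc.prems(1)]] by simp
  qed
  show ?case
    unfolding box_power_Suc boxplus_eq[OF Suc.prems(1)] by (rule sum.neutral) (use vanish in blast)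
qed

lemma graded_part_eq_0: "p \<in> Parts k \<Longrightarrow> k \<noteq> i \<Longrightarrow> graded_part i \<phi> p = 0"
  using deg_Parts by (auto simp: graded_part_def)

text \<open>The \<open>j\<close>-th power of a form of degree \<open>2\<close> lives in degree \<open>2 * j\<close>, so the exponential series has at most one
  non-zero term.\<close>

lemma box_exp_graded_part_2:
  assumes "p \<in> Parts k"
  shows "box_exp (graded_part 2 \<phi>) p =
    (if even k then box_power (graded_part 2 \<phi>) (k div 2) p / fact (k div 2) else 0)"
proof -
  have z: "box_power (graded_part 2 \<phi>) j p = 0" if "k \<noteq> 2 * j" for j
    using that by (intro box_power_homogeneous[OF graded_part_eq_0 assms])
  have "box_exp (graded_part 2 \<phi>) p = (\<Sum>j\<in>{k div 2}. box_power (graded_part 2 \<phi>) j p / fact j)"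
    unfolding box_exp_def by (rule suminf_finite) (auto intro!: z)
  moreover have "k \<noteq> 2 * (k div 2)" if "odd k" using that by presburger
  ultimately show ?thesis using z[of "k div 2"] by simp
qed

text \<open>In degree \<open>2\<close> only the linear term of the exponential survives. Hence an exponential of this kind is the
  exponential of its own part of degree \<open>2\<close>, which is what it means to be Gaussian.\<close>

lemma graded_part_2_box_exp: "graded_part 2 (box_exp (graded_part 2 \<phi>)) = graded_part 2 \<phi>"
proof
  fix p
  show "graded_part 2 (box_exp (graded_part 2 \<phi>)) p = graded_part 2 \<phi> p"
  proof (cases "p \<in> Parts 2")
    case True
    have "box_power (graded_part 2 \<phi>) 1 p = boxplus (graded_part 2 \<phi>) box_unit p"
      by (simp add: box_power_def)
    then show ?thesis
      using True by (simp add: graded_part_def[of 2 "box_exp _"] box_exp_graded_part_2 boxplus_unit_right)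
  qed (simp add: graded_part_def)
qed


section \<open>The limit of rescaled powers\<close>

lemma binomial_over_power_limit:
  "(\<lambda>n. real (n choose j) / real n ^ j) \<longlonglongrightarrow> 1 / fact j"
proof -
  have "(\<lambda>n. (\<Prod>i<j. 1 - real i / real n) / fact j) \<longlonglongrightarrow> (\<Prod>i<j. 1 - 0) / fact j"
    by (intro tendsto_intros lim_const_over_n) simp
  moreover have "\<forall>\<^sub>F n in sequentially. (\<Prod>i<j. 1 - real i / real n) / fact j = real (n choose j) / real n ^ j"
    using eventually_gt_at_top[of 0]
  proof eventually_elim
    case (elim n)
    have "real (n choose j) = (\<Prod>i<j. real n - real i) / fact j"
      by (simp add: binomial_gbinomial gbinomial_prod_rev lessThan_atLeast0)
    moreover have "(\<Prod>i<j. real n - real i) = (\<Prod>i<j. real n * (1 - real i / real n))"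
      using elim by (intro prod.cong) (auto simp: field_simps)
    ultimately show ?case using elim by (simp add: prod.distrib)
  qed
  ultimately show ?thesis by (simp add: tendsto_cong)
qed

text \<open>The real limit behind the central limit theorem: \<open>n choose j\<close> grows like \<open>n ^ j / fact j\<close>, against the
  normalisation \<open>sqrt n ^ k\<close>. The limit is \<open>1 / fact j\<close> for \<open>k = 2 * j\<close> and \<open>0\<close> for \<open>k > 2 * j\<close>; both cases are covered by
  the convention \<open>0 ^ 0 = 1\<close>.\<close>

lemma scaled_binomial_limit:
  assumes "2 * j \<le> k"
  shows "(\<lambda>n. (1 / complex_of_real (sqrt (real n))) ^ k * of_nat (n choose j)) \<longlonglongrightarrow> 0 ^ (k - 2 * j) / fact j"
proof -
  have "(\<lambda>n. inverse (sqrt (real n))) \<longlonglongrightarrow> 0"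
    by (intro tendsto_inverse_0_at_top filterlim_compose[OF sqrt_at_top filterlim_real_sequentially])
  then have "(\<lambda>n. (1 / sqrt (real n)) ^ (k - 2 * j) * (real (n choose j) / real n ^ j)) \<longlonglongrightarrow>
      0 ^ (k - 2 * j) * (1 / fact j)"
    by (intro tendsto_mult tendsto_power binomial_over_power_limit) (simp add: inverse_eq_divide)
  moreover have "\<forall>\<^sub>F n in sequentially. (1 / sqrt (real n)) ^ (k - 2 * j) * (real (n choose j) / real n ^ j) =
      (1 / sqrt (real n)) ^ k * real (n choose j)"
    using eventually_gt_at_top[of 0]
  proof eventually_elim
    case (elim n)
    have "(1 / sqrt (real n)) ^ k = (1 / sqrt (real n)) ^ (k - 2 * j) * (1 / sqrt (real n)) ^ (2 * j)"
      using assms by (simp flip: power_add)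
    also have "(1 / sqrt (real n)) ^ (2 * j) = 1 / real n ^ j"
      by (simp add: power_mult power_divide)
    finally show ?case by simp
  qed
  ultimately have "(\<lambda>n. (1 / sqrt (real n)) ^ k * real (n choose j)) \<longlonglongrightarrow> 0 ^ (k - 2 * j) * (1 / fact j)"
    by (simp add: tendsto_cong)
  from tendsto_of_real[OF this, where ?'a = complex] show ?thesis by simp
qed

text \<open>Subtracting the unit from \<open>\<phi>\<close> leaves a form \<open>\<psi>\<close> that starts in degree \<open>2\<close>. The binomial expansion then has a
  number of terms that depends on \<open>k\<close> only, so the limit can be taken term by term.\<close>

lemma scaled_box_power_limit:
  assumes "\<phi> {} = 1" "\<And>p. p \<in> Parts 1 \<Longrightarrow> \<phi> p = 0" and p: "p \<in> Parts k"
  shows "(\<lambda>n. (1 / complex_of_real (sqrt (real n))) ^ k * box_power \<phi> n p)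
    \<longlonglongrightarrow> box_exp (graded_part 2 \<phi>) p"
proof -
  define \<psi> where "\<psi> p = \<phi> p - box_unit p" for p
  have low: "\<psi> q = 0" if "q \<in> Parts l" "l < 2" for q l
  proof -
    have "l = 0 \<or> l = 1" using that(2) by auto
    then show ?thesis
      using assms(1,2) that(1) Parts_eq_empty_iff[OF that(1)] by (auto simp: \<psi>_def box_unit_def)
  qed
  have expansion: "box_power \<phi> n p = (\<Sum>j\<le>k div 2. of_nat (n choose j) * box_power \<psi> j p)" for n
  proof -
    let ?t = "\<lambda>j. of_nat (n choose j) * box_power \<psi> j p"
    have z: "?t j = 0" if "j > n \<or> j > k div 2" for j
      using that box_power_eq_0[OF low p, where j = j] by auto
    \<comment> \<open>Both index ranges are embedded into a common larger one; the additional terms are zero either because \<open>n choose j = 0\<close> or by degree.\<close>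
    have "box_power \<phi> n p = sum ?t {..n}"
      by (rule box_power_binomial[OF _ p]) (simp add: \<psi>_def)
    also have "\<dots> = sum ?t {..n + k}"
      by (rule sum.mono_neutral_left) (use z in auto)
    also have "\<dots> = sum ?t {..k div 2}"
      by (rule sum.mono_neutral_right) (use z in auto)
    finally show ?thesis .
  qed
  let ?c = "\<lambda>n. (1 / complex_of_real (sqrt (real n))) ^ k"
  have "(\<lambda>n. \<Sum>j\<le>k div 2. (?c n * of_nat (n choose j)) * box_power \<psi> j p) \<longlonglongrightarrow>
      (\<Sum>j\<le>k div 2. 0 ^ (k - 2 * j) / fact j * box_power \<psi> j p)"
    by (intro tendsto_sum tendsto_mult scaled_binomial_limit tendsto_const) auto
  also have "(\<lambda>n. \<Sum>j\<le>k div 2. (?c n * of_nat (n choose j)) * box_power \<psi> j p) = (\<lambda>n. ?c n * box_power \<phi> n p)"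
    by (simp add: expansion sum_distrib_left mult.assoc)
  also have "(\<Sum>j\<le>k div 2. 0 ^ (k - 2 * j) / fact j * box_power \<psi> j p) =
      (if even k then box_power \<psi> (k div 2) p / fact (k div 2) else 0)"
  proof -
    have "(\<Sum>j\<le>k div 2. 0 ^ (k - 2 * j) / fact j * box_power \<psi> j p) =
        (\<Sum>j\<le>k div 2. if j = k div 2 then (if even k then box_power \<psi> j p / fact j else 0) else 0)"
    proof (rule sum.cong[OF refl])
      fix j assume j: "j \<in> {..k div 2}"
      have "k - 2 * j = 0 \<longleftrightarrow> j = k div 2 \<and> even k" using j unfolding atMost_iff by presburger
      then show "0 ^ (k - 2 * j) / fact j * box_power \<psi> j p =
          (if j = k div 2 then (if even k then box_power \<psi> j p / fact j else 0) else 0)"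
        by (auto simp: power_0_left)
    qed
    then show ?thesis by simp
  qed
  also have "\<dots> = box_exp (graded_part 2 \<phi>) p"
  proof (cases "even k")
    case True
    then have "p \<in> Parts (2 * (k div 2))" using p by simp
    then have "box_power \<psi> (k div 2) p = box_power (graded_part 2 \<phi>) (k div 2) p"
    proof (rule box_power_cong_Parts_2[rotated 3])
      show "\<psi> q = graded_part 2 \<phi> q" if "q \<in> Parts 2" for q
        using that Parts_eq_empty_iff[OF that] by (simp add: \<psi>_def box_unit_def graded_part_def)
    qed (use low graded_part_eq_0 in auto)
    then show ?thesis using True by (simp add: box_exp_graded_part_2[OF p])
  qed (simp add: box_exp_graded_part_2[OF p])
  finally show ?thesis .
qed


section \<open>Conjugation by a permutation relabels the columns\<close>

lemma components_eqI:
  assumes "{} \<notin> B" "partition_on (\<Union>B) r"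
    and "\<And>b. b \<in> B \<Longrightarrow> \<exists>c\<in>r. b \<subseteq> c"
    and "\<And>c. c \<in> r \<Longrightarrow> \<exists>d\<in>components B. c \<subseteq> d"
  shows "components B = r"
  using components_finest[OF assms(1,2,3)] components_partition[OF assms(1)] assms(2,4)
  by (intro refines_asym[of "\<Union>B"]) (auto simp: refines_def)

lemma components_image:
  assumes "{} \<notin> B" "inj f"
  shows "components ((`) f ` B) = (`) f ` components B"
proof (rule components_eqI)
  have P: "partition_on (\<Union>B) (components B)" by (rule components_partition[OF assms(1)])
  show "{} \<notin> (`) f ` B" using assms(1) by auto
  have "partition_on (f ` \<Union>B) ((`) f ` components B - {{}})"
    by (rule partition_on_inj_image[OF P]) (use assms(2) inj_on_subset in blast)
  moreover have "{} \<notin> (`) f ` components B" using P by (auto simp: partition_on_def)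
  moreover have "f ` \<Union>B = \<Union>((`) f ` B)" by blast
  ultimately show "partition_on (\<Union>((`) f ` B)) ((`) f ` components B)" by simp
  show "\<exists>c\<in>(`) f ` components B. b \<subseteq> c" if bB: "b \<in> (`) f ` B" for b
  proof -
    obtain b' where b': "b' \<in> B" "b = f ` b'" using bB by blast
    then obtain c where "c \<in> components B" "b' \<subseteq> c"
      using components_coarser[of b' B] assms(1) by blast
    then show ?thesis using b' by blast
  qed
  show "\<exists>d\<in>components ((`) f ` B). c \<subseteq> d" if c: "c \<in> (`) f ` components B" for c
  proof -
    define R where "R = {(x, y). \<exists>b\<in>B. x \<in> b \<and> y \<in> b}"
    define R' where "R' = {(x, y). \<exists>b\<in>(`) f ` B. x \<in> b \<and> y \<in> b}"
    obtain d where d: "d \<in> components B" "c = f ` d" using c by blast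
    then obtain x where x: "x \<in> \<Union>B" "d = R\<^sup>* `` {x}"
      by (auto simp: components_def quotient_def R_def)
    have "(f x, f y) \<in> R'\<^sup>*" if "(x, y) \<in> R\<^sup>*" for y
      using that
    proof induction
      case (step y z)
      then have "(f y, f z) \<in> R'" by (auto simp: R_def R'_def)
      with step.IH show ?case by (rule rtrancl_into_rtrancl)
    qed auto
    then have "c \<subseteq> R'\<^sup>* `` {f x}" using x d by auto
    moreover have "R'\<^sup>* `` {f x} \<in> components ((`) f ` B)"
      unfolding components_def R'_def[symmetric] using x by (intro quotientI) auto
    ultimately show ?thesis by blast
  qed
qed

lemma components_mem_eq:
  assumes "{} \<notin> B" "c \<in> components B" "d \<in> components B" "x \<in> c" "x \<in> d"
  shows "c = d"
  using components_partition[OF assms(1)] assms(2-) unfolding partition_on_def disjoint_def by blast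

lemma relabel_Parts:
  assumes "p \<in> Parts k" "\<sigma> permutes {..<k}"
  shows "relabel \<sigma> p \<in> Parts k"
  using relabel_partition_on[of "{Top, Bot}" "{..<k}" p \<sigma>] assms permutes_image[OF assms(2)]
    permutes_inj_on[OF assms(2)]
  by (simp add: Parts_def points_def)

text \<open>Attaching a new pendant vertex \<open>f x\<close> to each \<open>x \<in> S\<close> only enlarges the components by these vertices.
  This is all that happens in a composition with a permutation diagram: the middle row is the set \<open>S\<close>, and each of
  its points is joined to one point of an outer row.\<close>

lemma components_pendant:
  assumes q: "disjoint q" "{} \<notin> q" and S: "S \<subseteq> \<Union>q" "inj_on f S" "f ` S \<inter> \<Union>q = {}"
  shows "components (q \<union> (\<lambda>x. {x, f x}) ` S) = (\<lambda>b. b \<union> f ` (b \<inter> S)) ` q"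
proof (rule components_eqI)
  let ?B = "q \<union> (\<lambda>x. {x, f x}) ` S"
  show e: "{} \<notin> ?B" using q(2) by auto
  have mem: "b = c" if "b \<in> q" "c \<in> q" "x \<in> b" "x \<in> c" for b c x
    using q(1) that unfolding disjoint_def by blast
  show "partition_on (\<Union>?B) ((\<lambda>b. b \<union> f ` (b \<inter> S)) ` q)"
    unfolding partition_on_def
  proof (intro conjI)
    show "\<Union>((\<lambda>b. b \<union> f ` (b \<inter> S)) ` q) = \<Union>?B" using S(1) by blast
    show "{} \<notin> (\<lambda>b. b \<union> f ` (b \<inter> S)) ` q" using q(2) by auto
    have same: "b = c" if "b \<in> q" "c \<in> q" "x \<in> b \<union> f ` (b \<inter> S)" "x \<in> c \<union> f ` (c \<inter> S)" for b c x
    proof (cases "x \<in> \<Union>q")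
      case True
      then have "x \<in> b" "x \<in> c" using that S(3) by blast+
      then show ?thesis using mem that by blast
    next
      case False
      then have "x \<in> f ` (b \<inter> S)" "x \<in> f ` (c \<inter> S)" using that by blast+
      then obtain y z where "y \<in> b \<inter> S" "z \<in> c \<inter> S" "x = f y" "x = f z" by blast
      then show ?thesis using mem[OF that(1,2)] S(2) by (metis IntD1 IntD2 inj_onD)
    qed
    show "disjoint ((\<lambda>b. b \<union> f ` (b \<inter> S)) ` q)"
    proof (rule disjointI)
      fix X Y assume XY: "X \<in> (\<lambda>b. b \<union> f ` (b \<inter> S)) ` q" "Y \<in> (\<lambda>b. b \<union> f ` (b \<inter> S)) ` q" "X \<noteq> Y"
      obtain b where b: "b \<in> q" "X = b \<union> f ` (b \<inter> S)" using XY(1) by (rule imageE)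
      obtain c where c: "c \<in> q" "Y = c \<union> f ` (c \<inter> S)" using XY(2) by (rule imageE)
      have "x \<notin> Y" if "x \<in> X" for x
        using same[OF b(1) c(1), of x] that XY(3) unfolding b(2) c(2) by metis
      then show "X \<inter> Y = {}" by auto
    qed
  qed
  show "\<exists>c\<in>(\<lambda>b. b \<union> f ` (b \<inter> S)) ` q. b \<subseteq> c" if bB: "b \<in> ?B" for b
  proof (cases "b \<in> q")
    case False
    then obtain x where x: "x \<in> S" "b = {x, f x}" using bB by blast
    then obtain c where "c \<in> q" "x \<in> c" using S(1) by blast
    then have "b \<subseteq> c \<union> f ` (c \<inter> S)" using x by auto
    then show ?thesis using \<open>c \<in> q\<close> by (intro bexI[OF _ imageI])
  next
    case True
    then show ?thesis by (intro bexI[OF _ imageI]) auto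
  qed
  show "\<exists>d\<in>components ?B. c \<subseteq> d" if c: "c \<in> (\<lambda>b. b \<union> f ` (b \<inter> S)) ` q" for c
  proof -
    obtain b where b: "b \<in> q" "c = b \<union> f ` (b \<inter> S)" using c by blast
    have "b \<noteq> {}" using b(1) q(2) by blast
    then obtain d where d: "d \<in> components ?B" "b \<subseteq> d"
      using components_coarser[of b ?B] b(1) by blast
    have "f x \<in> d" if x: "x \<in> b \<inter> S" for x
    proof -
      obtain d' where d': "d' \<in> components ?B" "{x, f x} \<subseteq> d'"
        using components_coarser[of "{x, f x}" ?B] x by blast
      then have "d = d'" using components_mem_eq[OF e d(1) d'(1), of x] d(2) x by blast
      then show ?thesis using d' by blast
    qed
    then show ?thesis using d b by blast
  qed
qed

text \<open>Composition with a permutation on one side moves the points of a single row \<open>s\<close>; the conjugation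
  combines two such moves.\<close>

definition relabel_row :: "row \<Rightarrow> (nat \<Rightarrow> nat) \<Rightarrow> row \<times> nat \<Rightarrow> row \<times> nat" where
  "relabel_row s f x = (fst x, if fst x = s then f (snd x) else snd x)"

text \<open>Each edge of the permutation diagram hangs a point of the bottom row on a point of the middle row. Erasing the
  middle row leaves each block of \<open>p\<close> with its bottom points moved by \<open>\<sigma>\<close>.\<close>

lemma part_compose_perm_left:
  assumes p: "p \<in> Parts k" and s: "\<sigma> permutes {..<k}"
  shows "part_compose (perm_part k \<sigma>) p = (`) (relabel_row Bot \<sigma>) ` p"
proof -
  note P = Parts_D[OF p]
  let ?u = "map_prod upper_row id" and ?S = "{Mid} \<times> {..<k}" and ?f = "\<lambda>x. (Bot, \<sigma> (snd x))"
  let ?g = "\<lambda>b. b \<union> ?f ` (b \<inter> ?S)"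
  have edges: "(`) (map_prod lower_row id) ` perm_part k \<sigma> = (\<lambda>x. {x, ?f x}) ` ?S"
  proof -
    have "perm_part k \<sigma> = (\<lambda>i. {(Top, i), (Bot, \<sigma> i)}) ` {..<k}"
      unfolding perm_part_def by auto
    moreover have "?S = Pair Mid ` {..<k}" by auto
    ultimately show ?thesis by (simp add: image_image)
  qed
  have un: "\<Union>((`) ?u ` p) = {Top, Mid} \<times> {..<k}"
  proof -
    have "\<Union>((`) ?u ` p) = ?u ` points k" using P(1) by blast
    then show ?thesis by (force simp: points_def image_iff)
  qed
  have "components ((`) ?u ` p \<union> (\<lambda>x. {x, ?f x}) ` ?S) = ?g ` (`) ?u ` p"
  proof (rule components_pendant)
    have "inj_on ?u (\<Union>p)" unfolding P(1) points_def by (auto simp: inj_on_def)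
    then show "disjoint ((`) ?u ` p)"
      using p by (intro disjoint_image) (auto simp: Parts_def partition_on_def)
    show "inj_on ?f ?S" using permutes_inj_on[OF s] by (auto simp: inj_on_def)
  qed (use P(2) un in auto)
  then have "part_compose (perm_part k \<sigma>) p = (\<lambda>b. ?g (?u ` b) \<inter> {Top, Bot} \<times> UNIV) ` p - {{}}"
    unfolding part_compose_def edges by (simp only: image_image)
  also have "(\<lambda>b. ?g (?u ` b) \<inter> {Top, Bot} \<times> UNIV) ` p = (`) (relabel_row Bot \<sigma>) ` p"
  proof (rule image_cong[OF refl])
    fix b assume "b \<in> p"
    then have "b \<subseteq> {Top, Bot} \<times> {..<k}" using P(1) unfolding points_def by blast
    then show "?g (?u ` b) \<inter> {Top, Bot} \<times> UNIV = relabel_row Bot \<sigma> ` b"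
      by (force simp: relabel_row_def image_iff)
  qed
  also have "(`) (relabel_row Bot \<sigma>) ` p - {{}} = (`) (relabel_row Bot \<sigma>) ` p" using P(2) by auto
  finally show ?thesis .
qed

lemma part_compose_perm_right:
  assumes p: "p \<in> Parts k" and s: "\<sigma> permutes {..<k}"
  shows "part_compose p (perm_part k (inv \<sigma>)) = (`) (relabel_row Top \<sigma>) ` p"
proof -
  note P = Parts_D[OF p]
  let ?u = "map_prod lower_row id" and ?S = "{Mid} \<times> {..<k}" and ?f = "\<lambda>x. (Top, \<sigma> (snd x))"
  let ?g = "\<lambda>b. b \<union> ?f ` (b \<inter> ?S)"
  have edges: "(`) (map_prod upper_row id) ` perm_part k (inv \<sigma>) = (\<lambda>x. {x, ?f x}) ` ?S"
  proof -
    have "perm_part k (inv \<sigma>) = (\<lambda>i. {(Top, \<sigma> i), (Bot, i)}) ` {..<k}"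
    proof (intro equalityI subsetI)
      fix b assume "b \<in> perm_part k (inv \<sigma>)"
      then obtain i where i: "i < k" "b = {(Top, i), (Bot, inv \<sigma> i)}" by (auto simp: perm_part_def)
      then have "inv \<sigma> i < k" "\<sigma> (inv \<sigma> i) = i"
        using permutes_in_image[OF permutes_inv[OF s]] permutes_inverses[OF s] by auto
      then show "b \<in> (\<lambda>i. {(Top, \<sigma> i), (Bot, i)}) ` {..<k}" using i by (intro image_eqI[of _ _ "inv \<sigma> i"]) auto
    next
      fix b assume "b \<in> (\<lambda>i. {(Top, \<sigma> i), (Bot, i)}) ` {..<k}"
      then obtain i where i: "i < k" "b = {(Top, \<sigma> i), (Bot, i)}" by auto
      then have "\<sigma> i < k" "inv \<sigma> (\<sigma> i) = i"
        using permutes_in_image[OF s] permutes_inverses[OF s] by auto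
      then show "b \<in> perm_part k (inv \<sigma>)" using i unfolding perm_part_def by force
    qed
    moreover have "?S = Pair Mid ` {..<k}" by auto
    ultimately show ?thesis by (simp add: image_image insert_commute)
  qed
  have un: "\<Union>((`) ?u ` p) = {Mid, Bot} \<times> {..<k}"
  proof -
    have "\<Union>((`) ?u ` p) = ?u ` points k" using P(1) by blast
    then show ?thesis by (force simp: points_def image_iff)
  qed
  have "components ((`) ?u ` p \<union> (\<lambda>x. {x, ?f x}) ` ?S) = ?g ` (`) ?u ` p"
  proof (rule components_pendant)
    have "inj_on ?u (\<Union>p)" unfolding P(1) points_def by (auto simp: inj_on_def)
    then show "disjoint ((`) ?u ` p)"
      using p by (intro disjoint_image) (auto simp: Parts_def partition_on_def)
    show "inj_on ?f ?S" using permutes_inj_on[OF s] by (auto simp: inj_on_def)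
  qed (use P(2) un in auto)
  then have "part_compose p (perm_part k (inv \<sigma>)) = (\<lambda>b. ?g (?u ` b) \<inter> {Top, Bot} \<times> UNIV) ` p - {{}}"
    unfolding part_compose_def edges by (simp only: image_image Un_commute)
  also have "(\<lambda>b. ?g (?u ` b) \<inter> {Top, Bot} \<times> UNIV) ` p = (`) (relabel_row Top \<sigma>) ` p"
  proof (rule image_cong[OF refl])
    fix b assume "b \<in> p"
    then have "b \<subseteq> {Top, Bot} \<times> {..<k}" using P(1) unfolding points_def by blast
    then show "?g (?u ` b) \<inter> {Top, Bot} \<times> UNIV = relabel_row Top \<sigma> ` b"
      by (force simp: relabel_row_def image_iff)
  qed
  also have "(`) (relabel_row Top \<sigma>) ` p - {{}} = (`) (relabel_row Top \<sigma>) ` p" using P(2) by auto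
  finally show ?thesis .
qed

lemma conj_part_eq:
  assumes p: "p \<in> Parts k" and s: "\<sigma> permutes {..<k}"
  shows "conj_part k \<sigma> p = relabel \<sigma> p"
proof -
  let ?q = "(`) (relabel_row Bot \<sigma>) ` p"
  have inj: "inj_on (relabel_row Bot \<sigma>) (points k)"
  proof (rule inj_onI)
    fix x y assume *: "relabel_row Bot \<sigma> x = relabel_row Bot \<sigma> y"
    then have "fst x = fst y" by (simp add: relabel_row_def)
    moreover from this have "snd x = snd y"
      using * injD[OF permutes_inj[OF s], of "snd x" "snd y"] by (simp add: relabel_row_def split: if_splits)
    ultimately show "x = y" by (rule prod_eqI)
  qed
  moreover have "relabel_row Bot \<sigma> ` points k \<subseteq> points k"
  proof -
    have "\<sigma> i < k \<longleftrightarrow> i < k" for i using permutes_in_image[OF s, of i] by simp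
    then show ?thesis by (intro image_subsetI) (simp add: relabel_row_def points_def mem_Times_iff)
  qed
  then have "relabel_row Bot \<sigma> ` points k = points k"
    using endo_inj_surj[OF _ _ inj] finite_cartesian_product unfolding points_def by blast
  moreover have "{} \<notin> ?q" using Parts_D(2)[OF p] by auto
  ultimately have "?q \<in> Parts k"
    using partition_on_inj_image[of "points k" p "relabel_row Bot \<sigma>"] p by (simp add: Parts_def)
  then have "conj_part k \<sigma> p = (`) (relabel_row Top \<sigma>) ` ?q"
    unfolding conj_part_def part_compose_perm_left[OF p s] by (rule part_compose_perm_right[OF _ s])
  also have "\<dots> = relabel \<sigma> p"
    unfolding relabel_def image_image
  proof (rule image_cong[OF refl])
    fix b assume "b \<in> p"
    then have "b \<subseteq> points k" using Parts_D(1)[OF p] by blast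
    then show "(\<lambda>x. relabel_row Top \<sigma> (relabel_row Bot \<sigma> x)) ` b = map_prod id \<sigma> ` b"
      by (intro image_cong) (auto simp: relabel_row_def points_def)
  qed
  finally show ?thesis .
qed

lemma relabel_id_part:
  assumes "\<sigma> permutes {..<k}"
  shows "relabel \<sigma> (id_part k) = id_part k"
proof -
  have "id_part k = (\<lambda>i. {(Top, i), (Bot, i)}) ` {..<k}"
    by (auto simp: id_part_def perm_part_def)
  moreover have "relabel \<sigma> ((\<lambda>i. {(Top, i), (Bot, i)}) ` {..<k}) = (\<lambda>i. {(Top, i), (Bot, i)}) ` \<sigma> ` {..<k}"
    by (simp add: relabel_def image_image)
  ultimately show ?thesis using permutes_image[OF assms] by simp
qed

text \<open>A bijection of the points commutes with joins and preserves the number of blocks.\<close>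

lemma part_dist_relabel:
  assumes "p \<in> Parts k" "q \<in> Parts k" "\<sigma> permutes {..<k}"
  shows "part_dist (relabel \<sigma> p) (relabel \<sigma> q) = part_dist p q"
proof -
  have inj: "inj (map_prod (id :: row \<Rightarrow> row) \<sigma>)"
    using permutes_inj[OF assms(3)] by (auto simp: inj_def)
  then have inj': "inj ((`) (map_prod (id :: row \<Rightarrow> row) \<sigma>))"
    by (auto intro: injI simp: inj_image_eq_iff)
  then have card: "card (relabel \<sigma> r) = card r" for r
    unfolding relabel_def by (intro card_image) (rule inj_on_subset, auto)
  have "join (relabel \<sigma> p) (relabel \<sigma> q) = components ((`) (map_prod id \<sigma>) ` (p \<union> q))"
    using join_eq_components[OF relabel_Parts[OF assms(1,3)] relabel_Parts[OF assms(2,3)]]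
    by (simp add: relabel_def image_Un)
  also have "\<dots> = relabel \<sigma> (join p q)"
    unfolding join_eq_components[OF assms(1,2)] relabel_def
    using Parts_D(2)[OF assms(1)] Parts_D(2)[OF assms(2)] by (intro components_image inj) auto
  finally show ?thesis by (simp add: part_dist_def nc_def card)
qed

lemma part_le_relabel:
  assumes "p \<in> Parts k" "q \<in> Parts k" "\<sigma> permutes {..<k}"
  shows "part_le k (relabel \<sigma> p) (relabel \<sigma> q) \<longleftrightarrow> part_le k p q"
  unfolding part_le_def
  using part_dist_relabel[OF assms] part_dist_relabel[OF id_part_Parts assms(1,3)]
    part_dist_relabel[OF id_part_Parts assms(2,3)] relabel_id_part[OF assms(3)] by simp

lemma relabel_inverse:
  assumes "\<sigma> permutes {..<k}"
  shows "relabel (inv \<sigma>) (relabel \<sigma> p) = p" "relabel \<sigma> (relabel (inv \<sigma>) p) = p"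
  using permutes_inv_o[OF assms] by (simp_all add: relabel_comp relabel_id)

lemma part_less_relabel_bij:
  assumes "p \<in> Parts k" "\<sigma> permutes {..<k}"
  shows "bij_betw (relabel \<sigma>) {q. (q, p) \<in> part_less} {q. (q, relabel \<sigma> p) \<in> part_less}"
proof (rule bij_betw_byWitness[where f' = "relabel (inv \<sigma>)"])
  have less: "(q, p) \<in> part_less \<longleftrightarrow> q \<in> Parts k \<and> part_le k q p \<and> q \<noteq> p" if "p \<in> Parts k" for p q
    using that deg_Parts by (auto simp: part_less_def)
  have le: "(relabel \<sigma> q, relabel \<sigma> p) \<in> part_less" if "(q, p) \<in> part_less" "p \<in> Parts k" "\<sigma> permutes {..<k}" for \<sigma> p q
    using that less[OF that(2)] less[OF relabel_Parts[OF that(2,3)]] part_le_relabel[OF _ that(2,3)]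
      relabel_Parts[OF _ that(3)] relabel_inverse(1)[OF that(3)] by metis
  show "relabel \<sigma> ` {q. (q, p) \<in> part_less} \<subseteq> {q. (q, relabel \<sigma> p) \<in> part_less}"
    using le assms by auto
  show "relabel (inv \<sigma>) ` {q. (q, relabel \<sigma> p) \<in> part_less} \<subseteq> {q. (q, p) \<in> part_less}"
    using le[OF _ relabel_Parts[OF assms] permutes_inv[OF assms(2)]] relabel_inverse(1)[OF assms(2)] by auto
qed (use relabel_inverse[OF assms(2)] in auto)


section \<open>Cumulants of relabelled partitions and of sums\<close>

lemma is_cumulants_cumulants:
  assumes "P_tracial_algebra scale m"
  shows "is_cumulants scale m (cumulants scale m)"
  unfolding cumulants_def by (rule theI'[OF is_cumulants_unique_existence[OF assms]])

lemma cumulants_recursion: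
  assumes "P_tracial_algebra scale m" "p \<in> Parts (length xs)"
  shows "cumulants scale m p xs = m p xs - (\<Sum>q | (q, p) \<in> part_less. cumulants scale m q xs)"
proof -
  have "m p xs = (\<Sum>q\<in>{q \<in> Parts (length xs). part_le (length xs) q p}. cumulants scale m q xs)"
    using is_cumulants_cumulants[OF assms(1)] assms(2) unfolding is_cumulants_def by blast
  then show ?thesis by (simp add: sum_part_le[OF assms(2)])
qed

lemma part_less_Parts: "(q, p) \<in> part_less \<Longrightarrow> p \<in> Parts k \<Longrightarrow> q \<in> Parts k"
  using deg_Parts by (auto simp: part_less_def)

text \<open>The moments are invariant and the order is invariant, so the cumulants, which are determined by the moments
  recursively along the order, are invariant too.\<close>

lemma cumulants_relabel:
  assumes "P_tracial_algebra scale m" "p \<in> Parts (length xs)" "\<sigma> permutes {..<length xs}"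
  shows "cumulants scale m (relabel \<sigma> p) (permute_list (inv \<sigma>) xs) = cumulants scale m p xs"
  using assms(2)
proof (induction p rule: wf_induct_rule[OF wf_part_less])
  case (1 p)
  let ?k = "length xs" and ?ys = "permute_list (inv \<sigma>) xs" and ?\<kappa> = "cumulants scale m"
  have "m p xs = m (relabel \<sigma> p) ?ys"
    using assms(1,3) 1(2) conj_part_eq[OF 1(2) assms(3)] unfolding P_tracial_algebra_def by metis
  moreover have "(\<Sum>q | (q, relabel \<sigma> p) \<in> part_less. ?\<kappa> q ?ys) =
      (\<Sum>q | (q, p) \<in> part_less. ?\<kappa> (relabel \<sigma> q) ?ys)"
    by (rule sum.reindex_bij_betw[OF part_less_relabel_bij[OF 1(2) assms(3)], symmetric])
  moreover have "\<dots> = (\<Sum>q | (q, p) \<in> part_less. ?\<kappa> q xs)"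
    using 1 part_less_Parts by (intro sum.cong) auto
  moreover have "relabel \<sigma> p \<in> Parts (length ?ys)"
    using relabel_Parts[OF 1(2) assms(3)] by simp
  ultimately show ?case
    using cumulants_recursion[OF assms(1) 1(2)] cumulants_recursion[OF assms(1), of "relabel \<sigma> p" ?ys]
    by simp
qed

text \<open>The same recursion, applied to constant lists of arguments, shows that the distribution determines the
  R-transform.\<close>

lemma R_transform_cong:
  assumes "P_tracial_algebra scale m"
    and "\<And>p. p \<in> All_Parts \<Longrightarrow> P_distribution m a p = P_distribution m b p"
    and "p \<in> Parts k"
  shows "R_transform scale m a p = R_transform scale m b p"
  using assms(3)
proof (induction p rule: wf_induct_rule[OF wf_part_less])
  case (1 p)
  have rec: "R_transform scale m c p = P_distribution m c p - (\<Sum>q | (q, p) \<in> part_less. R_transform scale m c q)" for c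
    using cumulants_recursion[OF assms(1), of p "replicate k c"] 1(2)
    by (simp add: R_transform_def P_distribution_def deg_Parts part_less_Parts[OF _ 1(2), THEN deg_Parts])
  have "(\<Sum>q | (q, p) \<in> part_less. R_transform scale m a q) = (\<Sum>q | (q, p) \<in> part_less. R_transform scale m b q)"
    using 1 part_less_Parts by (intro sum.cong) auto
  then show ?case
    using assms(2)[of p] 1(2) by (simp add: rec All_Parts_def) blast
qed

lemma multilinear_sum:
  assumes "complex_algebra scale" "multilinear scale f" "p \<in> Parts (length xs)" "i < length xs"
  shows "f p (xs[i := \<Sum>t\<in>T. y t]) = (\<Sum>t\<in>T. f p (xs[i := y t]))"
proof (induction T rule: infinite_finite_induct)
  case (insert t T)
  then show ?case using assms unfolding multilinear_def by simp
next
  interpret complex_algebra scale by (rule assms(1))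
  have "f p (xs[i := scale 0 0]) = 0 * f p (xs[i := 0])"
    using assms unfolding multilinear_def by blast
  then have z: "f p (xs[i := 0]) = 0" by simp
  { case empty then show ?case using z by simp }
  { case infinite then show ?case using z by simp }
qed

text \<open>The entries are expanded one after the other, from left to right.\<close>

lemma multilinear_replicate_sum:
  assumes "complex_algebra scale" "multilinear scale f" "p \<in> Parts k"
  shows "f p (replicate k (\<Sum>t\<in>T. y t)) = (\<Sum>\<epsilon>\<in>{..<k} \<rightarrow>\<^sub>E T. f p (map (\<lambda>i. y (\<epsilon> i)) [0..<k]))"
proof -
  define s where "s = (\<Sum>t\<in>T. y t)"
  have expand: "f p (replicate k s) = (\<Sum>\<epsilon>\<in>{..<j} \<rightarrow>\<^sub>E T. f p (map (\<lambda>i. if i < j then y (\<epsilon> i) else s) [0..<k]))"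
    if "j \<le> k" for j
    using that
  proof (induction j)
    case 0
    then show ?case by (simp add: map_replicate_const)
  next
    case (Suc j)
    let ?L = "\<lambda>\<epsilon>. map (\<lambda>i. if i < j then y (\<epsilon> i) else s) [0..<k]"
    have "f p (?L \<epsilon>) = (\<Sum>t\<in>T. f p (map (\<lambda>i. if i < Suc j then y ((\<epsilon>(j := t)) i) else s) [0..<k]))" for \<epsilon>
    proof -
      have "f p (?L \<epsilon>) = f p ((?L \<epsilon>)[j := s])"
        using Suc.prems by (intro arg_cong[of _ _ "f p"] nth_equalityI) (auto simp: nth_list_update)
      also have "\<dots> = (\<Sum>t\<in>T. f p ((?L \<epsilon>)[j := y t]))"
        unfolding s_def using Suc.prems assms by (intro multilinear_sum) auto
      also have "(\<lambda>t. (?L \<epsilon>)[j := y t]) = (\<lambda>t. map (\<lambda>i. if i < Suc j then y ((\<epsilon>(j := t)) i) else s) [0..<k])"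
        by (intro ext nth_equalityI) (auto simp: nth_list_update less_Suc_eq)
      finally show ?thesis by meson
    qed
    then have "f p (replicate k s) = (\<Sum>\<epsilon>\<in>{..<j} \<rightarrow>\<^sub>E T. \<Sum>t\<in>T. f p (map (\<lambda>i. if i < Suc j then y ((\<epsilon>(j := t)) i) else s) [0..<k]))"
      using Suc by simp
    also have "\<dots> = (\<Sum>(t, \<epsilon>)\<in>T \<times> ({..<j} \<rightarrow>\<^sub>E T). f p (map (\<lambda>i. if i < Suc j then y ((\<epsilon>(j := t)) i) else s) [0..<k]))"
      by (subst sum.swap) (simp add: sum.cartesian_product)
    also have "\<dots> = (\<Sum>\<epsilon>\<in>(\<lambda>(t, \<epsilon>). \<epsilon>(j := t)) ` (T \<times> ({..<j} \<rightarrow>\<^sub>E T)). f p (map (\<lambda>i. if i < Suc j then y (\<epsilon> i) else s) [0..<k]))"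
      using inj_combinator[of j "{..<j}" "\<lambda>_. T"] by (subst sum.reindex) (auto simp: case_prod_unfold)
    also have "(\<lambda>(t, \<epsilon>). \<epsilon>(j := t)) ` (T \<times> ({..<j} \<rightarrow>\<^sub>E T)) = {..<Suc j} \<rightarrow>\<^sub>E T"
      using PiE_insert_eq[of j "{..<j}" "\<lambda>_. T"] by (simp add: lessThan_Suc)
    finally show ?case .
  qed
  have "map (\<lambda>i. if i < k then y (\<epsilon> i) else s) [0..<k] = map (\<lambda>i. y (\<epsilon> i)) [0..<k]" for \<epsilon>
    by (rule map_cong) auto
  with expand[of k] show ?thesis by (simp add: s_def)
qed

lemma multilinear_replicate_scale:
  assumes "multilinear scale f" "p \<in> Parts k"
  shows "f p (replicate k (scale c x)) = c ^ k * f p (replicate k x)"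
proof -
  have expand: "f p (map (\<lambda>i. if i < j then scale c x else x) [0..<k]) = c ^ j * f p (replicate k x)"
    if "j \<le> k" for j
    using that
  proof (induction j)
    case 0
    then show ?case by (simp add: map_replicate_const)
  next
    case (Suc j)
    let ?L = "map (\<lambda>i. if i < j then scale c x else x) [0..<k]"
    have "map (\<lambda>i. if i < Suc j then scale c x else x) [0..<k] = ?L[j := scale c x]"
      by (intro nth_equalityI) (auto simp: nth_list_update less_Suc_eq)
    moreover have "f p (?L[j := scale c x]) = c * f p (?L[j := x])"
      using assms Suc.prems unfolding multilinear_def by auto
    moreover have "?L[j := x] = ?L"
      using Suc.prems by (intro nth_equalityI) (auto simp: nth_list_update)
    ultimately show ?case using Suc by simp
  qed
  have "map (\<lambda>i. if i < k then scale c x else x) [0..<k] = replicate k (scale c x)"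
    by (intro nth_equalityI) auto
  with expand[of k] show ?thesis by simp
qed


section \<open>Sorting columns by colour\<close>

abbreviation fibre :: "nat \<Rightarrow> (nat \<Rightarrow> 'b) \<Rightarrow> 'b \<Rightarrow> nat set" where
  "fibre k \<epsilon> j \<equiv> {i. i < k \<and> \<epsilon> i = j}"

text \<open>The place of column \<open>i\<close> after a stable sort of the columns by colour, the colours in the order given by
  the list \<open>js\<close>.\<close>

primrec position :: "nat \<Rightarrow> (nat \<Rightarrow> 'b) \<Rightarrow> 'b list \<Rightarrow> nat \<Rightarrow> nat" where
  "position k \<epsilon> [] i = i"
| "position k \<epsilon> (j # js) i =
    (if \<epsilon> i = j then rank (fibre k \<epsilon> j) i else card (fibre k \<epsilon> j) + position k \<epsilon> js i)"

lemma position_bij: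
  assumes "distinct js"
  shows "bij_betw (position k \<epsilon> js) {i. i < k \<and> \<epsilon> i \<in> set js} {..<(\<Sum>j\<leftarrow>js. card (fibre k \<epsilon> j))}"
  using assms
proof (induction js)
  case (Cons j js)
  let ?c = "card (fibre k \<epsilon> j)" and ?U = "{i. i < k \<and> \<epsilon> i \<in> set js}" and ?N = "\<Sum>j\<leftarrow>js. card (fibre k \<epsilon> j)"
  have "bij_betw (rank (fibre k \<epsilon> j)) (fibre k \<epsilon> j) {..<?c}" by (rule rank_bij) simp
  then have 1: "bij_betw (position k \<epsilon> (j # js)) (fibre k \<epsilon> j) {..<?c}"
    by (subst bij_betw_cong[where g = "rank (fibre k \<epsilon> j)"]) simp_all
  have "bij_betw ((+) ?c \<circ> position k \<epsilon> js) ?U {?c..<?c + ?N}"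
  proof (rule bij_betw_trans)
    show "bij_betw (position k \<epsilon> js) ?U {..<?N}" using Cons by simp
    show "bij_betw ((+) ?c) {..<?N} {?c..<?c + ?N}"
      by (rule bij_betw_byWitness[where f' = "\<lambda>i. i - ?c"]) auto
  qed
  then have 2: "bij_betw (position k \<epsilon> (j # js)) ?U {?c..<?c + ?N}"
    using Cons.prems by (subst bij_betw_cong[where g = "(+) ?c \<circ> position k \<epsilon> js"]) auto
  have "fibre k \<epsilon> j \<union> ?U = {i. i < k \<and> \<epsilon> i \<in> set (j # js)}" by auto
  moreover have "{..<?c} \<union> {?c..<?c + ?N} = {..<\<Sum>j\<leftarrow>j # js. card (fibre k \<epsilon> j)}" by auto
  moreover have "{..<?c} \<inter> {?c..<?c + ?N} = {}" by auto
  ultimately show ?case using bij_betw_combine[OF 1 2] by (simp only:)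
qed (simp add: bij_betw_def)

lemma nth_concat_position:
  assumes "i < k" "\<epsilon> i \<in> set js"
  shows "concat (map (\<lambda>j. replicate (card (fibre k \<epsilon> j)) (a j)) js) ! position k \<epsilon> js i = a (\<epsilon> i)"
  using assms(2)
proof (induction js)
  case (Cons j js)
  show ?case
  proof (cases "\<epsilon> i = j")
    case True
    then have "rank (fibre k \<epsilon> j) i < card (fibre k \<epsilon> j)"
      using rank_bij[of "fibre k \<epsilon> j"] assms(1) by (auto simp: bij_betw_def)
    with True show ?thesis by (simp add: nth_append)
  qed (use Cons in \<open>simp add: nth_append\<close>)
qed simp

lemma relabel_Un: "relabel f (p \<union> q) = relabel f p \<union> relabel f q"
  by (simp add: relabel_def image_Un)

lemma restriction_Un:
  assumes "A \<inter> B = {}" "splits p (\<lambda>i. i \<in> A)"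
  shows "restriction p (A \<union> B) = restriction p A \<union> restriction p B"
proof -
  have *: "UNIV \<times> (A \<union> B) \<inter> b = UNIV \<times> A \<inter> b \<and> UNIV \<times> B \<inter> b = {} \<or>
      UNIV \<times> (A \<union> B) \<inter> b = UNIV \<times> B \<inter> b \<and> UNIV \<times> A \<inter> b = {}" if b: "b \<in> p" for b
  proof (cases "\<exists>x\<in>b. snd x \<in> A")
    case True
    then have "snd x \<in> A" if "x \<in> b" for x using assms(2) b that unfolding splits_def by blast
    then show ?thesis using assms(1) by fastforce
  next
    case False
    then show ?thesis by fastforce
  qed
  show ?thesis
    unfolding restriction_def
  proof (intro equalityI subsetI)
    fix c assume "c \<in> (\<inter>) (UNIV \<times> (A \<union> B)) ` p - {{}}"
    then obtain b where "b \<in> p" "c = UNIV \<times> (A \<union> B) \<inter> b" "c \<noteq> {}" by blast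
    then show "c \<in> ((\<inter>) (UNIV \<times> A) ` p - {{}}) \<union> ((\<inter>) (UNIV \<times> B) ` p - {{}})"
      using *[of b] by (metis (no_types, lifting) DiffI UnI1 UnI2 image_eqI singletonD)
  next
    fix c assume "c \<in> ((\<inter>) (UNIV \<times> A) ` p - {{}}) \<union> ((\<inter>) (UNIV \<times> B) ` p - {{}})"
    then obtain b where "b \<in> p" "c = UNIV \<times> A \<inter> b \<or> c = UNIV \<times> B \<inter> b" "c \<noteq> {}" by blast
    then show "c \<in> (\<inter>) (UNIV \<times> (A \<union> B)) ` p - {{}}"
      using *[of b] by (metis (no_types, lifting) DiffI image_eqI singletonD)
  qed
qed

text \<open>Sorting the columns by colour turns a partition with monochromatic blocks into a tensor product with one
  factor for each colour. A colour that does not occur yields an empty factor.\<close>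

lemma tensor_list_extractions:
  assumes "p \<in> Parts k" "splits p \<epsilon>" "distinct js"
  shows "tensor_list (map (\<lambda>j. extraction p (fibre k \<epsilon> j)) js) =
    relabel (position k \<epsilon> js) (restriction p {i. i < k \<and> \<epsilon> i \<in> set js})"
  using assms(3)
proof (induction js)
  case Nil
  then show ?case by (auto simp: tensor_list_def restriction_def relabel_def)
next
  case (Cons j js)
  let ?F = "fibre k \<epsilon> j" and ?U = "{i. i < k \<and> \<epsilon> i \<in> set js}"
  have "extraction p ?F \<in> Parts (card ?F)" by (rule extraction_Parts[OF assms(1)]) auto
  then have deg: "deg (extraction p ?F) = card ?F" by (rule deg_Parts)
  have "tensor_list (map (\<lambda>j. extraction p (fibre k \<epsilon> j)) (j # js)) =
      extraction p ?F \<union> relabel ((+) (card ?F)) (relabel (position k \<epsilon> js) (restriction p ?U))"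
    using Cons by (simp add: tensor_list_def tensor_def deg relabel_def)
  also have "relabel ((+) (card ?F)) (relabel (position k \<epsilon> js) (restriction p ?U)) =
      relabel (position k \<epsilon> (j # js)) (restriction p ?U)"
    unfolding relabel_comp using Cons.prems by (intro relabel_cong) (auto dest!: mem_restriction_snd)
  also have "extraction p ?F = relabel (position k \<epsilon> (j # js)) (restriction p ?F)"
    unfolding extraction_eq by (intro relabel_cong) (auto dest!: mem_restriction_snd)
  also have "relabel (position k \<epsilon> (j # js)) (restriction p ?F) \<union>
      relabel (position k \<epsilon> (j # js)) (restriction p ?U) =
      relabel (position k \<epsilon> (j # js)) (restriction p (?F \<union> ?U))"
  proof -
    have "splits p (\<lambda>i. i \<in> ?F)"
      using assms(2) Parts_block_column[OF assms(1)] unfolding splits_def mem_Collect_eq by metis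
    then have "restriction p (?F \<union> ?U) = restriction p ?F \<union> restriction p ?U"
      using Cons.prems by (intro restriction_Un) auto
    then show ?thesis by (simp add: relabel_Un)
  qed
  also have "?F \<union> ?U = {i. i < k \<and> \<epsilon> i \<in> set (j # js)}" by auto
  finally show ?case .
qed


section \<open>Cumulants of free elements\<close>

lemma mem_generated_algebra: "a \<in> generated_algebra scale a"
  unfolding generated_algebra_def by (rule hull_inc) simp

text \<open>The vanishing condition of freeness speaks of cycles and of the top row, whereas the two offending points
  may lie in the bottom row of a block. The identity diagram joins each point to the other point of its column, so that the
  cycle containing the block also contains the top points of both columns.\<close>

lemma cumulants_eq_0_if_not_splits:
  fixes a :: "nat \<Rightarrow> 'a::ring"
  assumes "P_free scale m {1..} a" "p \<in> Parts k" "\<epsilon> \<in> {..<k} \<rightarrow> {1..n}" "\<not> splits p \<epsilon>"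
  shows "cumulants scale m p (map (\<lambda>i. a (\<epsilon> i)) [0..<k]) = 0"
proof -
  obtain b r i s j where b: "b \<in> p" "(r, i) \<in> b" "(s, j) \<in> b" "\<epsilon> i \<noteq> \<epsilon> j"
    using assms(4) unfolding splits_def by (metis prod.collapse)
  note ref = join_refines[OF assms(2) id_part_Parts]
  obtain c where c: "c \<in> part_cycles k p" "b \<subseteq> c"
    using ref(1) b(1) unfolding part_cycles_def refines_def by blast
  have top: "(Top, l) \<in> c" if l: "(q, l) \<in> b" for q l
  proof -
    have "(q, l) \<in> points k" using Parts_D(1)[OF assms(2)] b(1) l by blast
    then have q: "q = Top \<or> q = Bot" "l < k" by (auto simp: points_def)
    then have "{(Top, l), (Bot, l)} \<in> id_part k" by (auto simp: id_part_def perm_part_def)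
    then obtain c' where c': "c' \<in> part_cycles k p" "{(Top, l), (Bot, l)} \<subseteq> c'"
      using ref(2) unfolding part_cycles_def refines_def by blast
    have "(q, l) \<in> c'" "(q, l) \<in> c" using c' q c l by auto
    then have "c' = c"
      using ref(1) c(1) c'(1) unfolding part_cycles_def refines_def partition_on_def disjoint_def by blast
    then show ?thesis using c' by blast
  qed
  have "\<exists>c\<in>part_cycles k p. \<exists>i j. (Top, i) \<in> c \<and> (Top, j) \<in> c \<and> \<epsilon> i \<noteq> \<epsilon> j"
    using c(1) top[OF b(2)] top[OF b(3)] b(4) by blast
  moreover have "\<forall>i<k. \<epsilon> i \<in> {1..} \<and> map (\<lambda>i. a (\<epsilon> i)) [0..<k] ! i \<in> generated_algebra scale (a (\<epsilon> i))"
    using assms(3) by (auto simp: mem_generated_algebra)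
  moreover have "length (map (\<lambda>i. a (\<epsilon> i)) [0..<k]) = k" by simp
  ultimately show ?thesis
    using assms(1,2) unfolding P_free_def by blast
qed

text \<open>Sort the columns by colour: the cumulant does not change, and the sorted partition is a tensor product, to
  which the second condition of freeness applies. All colours \<open>1, \<dots>, n\<close> take part, including those that
  \<open>\<epsilon>\<close> does not use, for which the factor is \<open>\<kappa> {} [] = 1\<close>.\<close>

lemma cumulants_eq_prod_if_splits:
  fixes a :: "nat \<Rightarrow> 'a::ring"
  assumes "P_tracial_algebra scale m" "P_free scale m {1..} a" "p \<in> Parts k"
    and \<epsilon>: "\<epsilon> \<in> {..<k} \<rightarrow> {1..n}" and "splits p \<epsilon>"
  shows "cumulants scale m p (map (\<lambda>i. a (\<epsilon> i)) [0..<k]) =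
    (\<Prod>j=1..n. R_transform scale m (a j) (extraction p (fibre k \<epsilon> j)))"
proof -
  let ?\<kappa> = "cumulants scale m" and ?xs = "map (\<lambda>i. a (\<epsilon> i)) [0..<k]"
  define js where "js = [1..<Suc n]"
  define ps where "ps = map (\<lambda>j. extraction p (fibre k \<epsilon> j)) js"
  define xss where "xss = map (\<lambda>j. replicate (card (fibre k \<epsilon> j)) (a j)) js"
  have js: "distinct js" "set js = {1..n}" "length js = n" unfolding js_def by auto
  have all: "{i. i < k \<and> \<epsilon> i \<in> set js} = {..<k}" using \<epsilon> js(2) by auto
  \<comment> \<open>The sorting permutation. It has to fix the numbers that are not columns of \<open>p\<close>, which \<open>position\<close> need not do.\<close>
  define \<sigma> where "\<sigma> i = (if i < k then position k \<epsilon> js i else i)" for i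
  have bij: "bij_betw (position k \<epsilon> js) {..<k} {..<(\<Sum>j\<leftarrow>js. card (fibre k \<epsilon> j))}"
    using position_bij[OF js(1), of k \<epsilon>] unfolding all .
  then have sum: "(\<Sum>j\<leftarrow>js. card (fibre k \<epsilon> j)) = k"
    using bij_betw_same_card by fastforce
  have "bij_betw \<sigma> {..<k} {..<k}"
    using bij unfolding sum by (subst bij_betw_cong[where g = "position k \<epsilon> js"]) (auto simp: \<sigma>_def)
  then have \<sigma>: "\<sigma> permutes {..<k}" by (rule bij_imp_permutes) (simp add: \<sigma>_def)
  have len: "length (concat xss) = k"
    using sum by (simp add: length_concat xss_def comp_def)
  have "relabel \<sigma> p = tensor_list ps"
    unfolding ps_def tensor_list_extractions[OF assms(3,5) js(1)] all restriction_id[OF assms(3)]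
    by (rule relabel_cong) (use Parts_block_column[OF assms(3)] in \<open>auto simp: \<sigma>_def\<close>)
  moreover have "permute_list (inv \<sigma>) ?xs = concat xss"
  proof (rule nth_equalityI)
    fix l assume "l < length (permute_list (inv \<sigma>) ?xs)"
    then have l: "l < k" by simp
    define i where "i = inv \<sigma> l"
    have i: "i < k" "\<sigma> i = l"
      using permutes_in_image[OF permutes_inv[OF \<sigma>], of l] l permutes_inverses(1)[OF \<sigma>]
      by (auto simp: i_def)
    have "permute_list (inv \<sigma>) ?xs ! l = ?xs ! i"
      unfolding i_def using l by (intro permute_list_nth) (auto intro: permutes_inv \<sigma>)
    also have "\<dots> = concat xss ! l"
    proof -
      have "\<epsilon> i \<in> set js" using \<epsilon> i(1) js(2) by auto
      then show ?thesis
        using nth_concat_position[of i k \<epsilon> js a] i unfolding xss_def by (simp add: \<sigma>_def)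
    qed
    finally show "permute_list (inv \<sigma>) ?xs ! l = concat xss ! l" .
  qed (simp add: len)
  ultimately have "?\<kappa> p ?xs = ?\<kappa> (tensor_list ps) (concat xss)"
    using cumulants_relabel[OF assms(1), of p ?xs \<sigma>] assms(3) \<sigma> by simp
  also have "\<dots> = (\<Prod>s<n. ?\<kappa> (ps ! s) (xss ! s))"
  proof -
    have "length ps = n \<and> length xss = n \<and> length js = n \<and> distinct js \<and> set js \<subseteq> {1..} \<and>
      (\<forall>s<n. ps ! s \<in> Parts (length (xss ! s)) \<and> set (xss ! s) \<subseteq> generated_algebra scale (a (js ! s)))"
    proof -
      have "extraction p (fibre k \<epsilon> j) \<in> Parts (card (fibre k \<epsilon> j))" for j
        by (rule extraction_Parts[OF assms(3)]) auto
      then show ?thesis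
        using js by (auto simp: ps_def xss_def mem_generated_algebra)
    qed
    then show ?thesis
      by (rule assms(2)[unfolded P_free_def, THEN conjunct2, THEN spec[of _ n], THEN spec[of _ ps],
            THEN spec[of _ xss], THEN spec[of _ js], THEN mp])
  qed
  also have "\<dots> = (\<Prod>s<n. R_transform scale m (a (Suc s)) (extraction p (fibre k \<epsilon> (Suc s))))"
  proof (rule prod.cong[OF refl])
    fix s assume "s \<in> {..<n}"
    then have "js ! s = Suc s" "s < length js" by (auto simp: js_def simp del: upt_Suc)
    moreover have "deg (extraction p (fibre k \<epsilon> (Suc s))) = card (fibre k \<epsilon> (Suc s))"
      by (rule deg_Parts[OF extraction_Parts[OF assms(3)]]) auto
    ultimately show "?\<kappa> (ps ! s) (xss ! s) =
      R_transform scale m (a (Suc s)) (extraction p (fibre k \<epsilon> (Suc s)))"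
      by (simp add: ps_def xss_def R_transform_def)
  qed
  also have "\<dots> = (\<Prod>j=1..n. R_transform scale m (a j) (extraction p (fibre k \<epsilon> j)))"
    by (rule prod.reindex_bij_witness[of _ "\<lambda>j. j - 1" Suc]) auto
  finally show ?thesis .
qed

text \<open>Both sides are the same sum over the colourings of the columns of \<open>p\<close> with colours \<open>1, \<dots>, n\<close> that split \<open>p\<close>:
  the colour of a column says which \<open>a i\<close> is put there, or which of the \<open>n\<close> factors takes the column.\<close>

lemma cumulants_sum_free_copies:
  fixes a :: "nat \<Rightarrow> 'a::ring"
  assumes m: "P_tracial_algebra scale m" and free: "P_free scale m {1..} a"
    and dist: "\<And>n p. n \<ge> 1 \<Longrightarrow> p \<in> All_Parts \<Longrightarrow> P_distribution m (a n) p = P_distribution m (a 1) p"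
    and p: "p \<in> Parts k"
  shows "cumulants scale m p (replicate k (\<Sum>i=1..n. a i)) = box_power (R_transform scale m (a 1)) n p"
proof -
  let ?\<kappa> = "cumulants scale m" and ?E = "{..<k} \<rightarrow>\<^sub>E {1..n}"
  have alg: "complex_algebra scale" and lin: "multilinear scale ?\<kappa>"
    using m is_cumulants_cumulants[OF m] by (auto simp: P_tracial_algebra_def is_cumulants_def)
  have "?\<kappa> p (replicate k (\<Sum>i=1..n. a i)) = (\<Sum>\<epsilon>\<in>?E. ?\<kappa> p (map (\<lambda>i. a (\<epsilon> i)) [0..<k]))"
    by (rule multilinear_replicate_sum[OF alg lin p])
  also have "\<dots> = (\<Sum>\<epsilon> | \<epsilon> \<in> ?E \<and> splits p \<epsilon>. ?\<kappa> p (map (\<lambda>i. a (\<epsilon> i)) [0..<k]))"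
    using cumulants_eq_0_if_not_splits[OF free p]
    by (intro sum.mono_neutral_right finite_PiE) (auto simp: PiE_def)
  also have "\<dots> = (\<Sum>\<epsilon> | \<epsilon> \<in> ?E \<and> splits p \<epsilon>.
      \<Prod>j=1..n. R_transform scale m (a 1) (extraction p {i. i < k \<and> \<epsilon> i = j}))"
  proof (rule sum.cong[OF refl])
    fix \<epsilon> assume \<epsilon>: "\<epsilon> \<in> {\<epsilon>. \<epsilon> \<in> ?E \<and> splits p \<epsilon>}"
    then have "?\<kappa> p (map (\<lambda>i. a (\<epsilon> i)) [0..<k]) =
        (\<Prod>j=1..n. R_transform scale m (a j) (extraction p (fibre k \<epsilon> j)))"
      by (intro cumulants_eq_prod_if_splits[OF m free p]) (auto simp: PiE_def)
    also have "\<dots> = (\<Prod>j=1..n. R_transform scale m (a 1) (extraction p (fibre k \<epsilon> j)))"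
    proof (rule prod.cong[OF refl])
      fix j assume "j \<in> {1..n}"
      moreover have "extraction p (fibre k \<epsilon> j) \<in> Parts (card (fibre k \<epsilon> j))"
        by (rule extraction_Parts[OF p]) auto
      ultimately show "R_transform scale m (a j) (extraction p (fibre k \<epsilon> j)) =
          R_transform scale m (a 1) (extraction p (fibre k \<epsilon> j))"
        using R_transform_cong[OF m dist[of j]] by simp
    qed
    finally show "?\<kappa> p (map (\<lambda>i. a (\<epsilon> i)) [0..<k]) =
        (\<Prod>j=1..n. R_transform scale m (a 1) (extraction p {i. i < k \<and> \<epsilon> i = j}))" .
  qed
  also have "\<dots> = box_power (R_transform scale m (a 1)) n p"
    by (rule box_power_eq_sum_colourings[OF p, symmetric])
  finally show ?thesis .
qed


section \<open>The central limit theorem\<close>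

theorem theorem2p5:
  fixes scale :: "complex \<Rightarrow> 'a::ring \<Rightarrow> 'a"
    and m :: "'a forms"
    and a :: "nat \<Rightarrow> 'a"
  assumes "P_tracial_algebra scale m"
    and "P_free scale m {1..} a"
    and "\<And>n p. n \<ge> 1 \<Longrightarrow> p \<in> All_Parts \<Longrightarrow> P_distribution m (a n) p = P_distribution m (a 1) p"
    and "\<And>p. p \<in> All_Parts \<Longrightarrow> graded_part 1 (R_transform scale m (a 1)) p = 0"
  defines "\<phi> \<equiv> box_exp (graded_part 2 (R_transform scale m (a 1)))"
  shows "P_converges m (\<lambda>n. scale (1 / complex_of_real (sqrt (real n))) (\<Sum>i=1..n. a i)) \<phi>
    \<and> Gaussian_R_transform \<phi>"
proof
  let ?\<kappa> = "cumulants scale m" and ?R = "R_transform scale m (a 1)"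
  let ?c = "\<lambda>n. scale (1 / complex_of_real (sqrt (real n))) (\<Sum>i=1..n. a i)"
  have cum: "is_cumulants scale m ?\<kappa>" by (rule is_cumulants_cumulants[OF assms(1)])
  have "{} \<in> Parts 0" by (simp add: Parts_def points_def partition_on_def)
  then have R0: "?R {} = 1"
    using cum deg_Parts[of "{}" 0] by (simp add: R_transform_def is_cumulants_def)
  have R1: "?R p = 0" if "p \<in> Parts 1" for p
    using assms(4)[of p] that by (auto simp: graded_part_def All_Parts_def)
  have lim: "(\<lambda>n. ?\<kappa> p (replicate k (?c n))) \<longlonglongrightarrow> \<phi> p" if p: "p \<in> Parts k" for k p
  proof -
    have "?\<kappa> p (replicate k (?c n)) = (1 / complex_of_real (sqrt (real n))) ^ k * box_power ?R n p" for n
      using multilinear_replicate_scale[of scale ?\<kappa> p k] cum p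
        cumulants_sum_free_copies[OF assms(1-3) p] by (simp add: is_cumulants_def)
    then show ?thesis
      unfolding \<phi>_def using scaled_box_power_limit[of ?R, OF R0 R1 p] by simp
  qed
  show "P_converges m ?c \<phi>"
    unfolding P_converges_def
  proof (intro allI ballI)
    fix k p assume p: "p \<in> Parts k"
    have "P_distribution m (?c n) p = (\<Sum>p'\<in>{p' \<in> Parts k. part_le k p' p}. ?\<kappa> p' (replicate k (?c n)))" for n
      using cum p by (simp add: P_distribution_def deg_Parts[OF p] is_cumulants_def)
    then show "(\<lambda>n. P_distribution m (?c n) p) \<longlonglongrightarrow> (\<Sum>p'\<in>{p' \<in> Parts k. part_le k p' p}. \<phi> p')"
      using lim by (auto intro!: tendsto_sum)
  qed
  show "Gaussian_R_transform \<phi>"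
    unfolding Gaussian_R_transform_def \<phi>_def graded_part_2_box_exp by simp
qed

end
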